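(* Let $A(z)$ be a non-constant rational function, $q\in\mathbb{C}\setminus\{0\}$ and $|q|\neq 1$. Suppose that $f(z)$ is a transcendental meromorphic solution of the $q$-difference Riccati equation $$f(qz)=\frac{A(z)+f(z)}{1-(q-1)z f(z)}.$$ Set $\Delta_{q}f(z)=\frac{f(qz)-f(z)}{(q-1)z}$. (1) If $A(z)\not\equiv -\frac{1}{(q-1)z}$, then $\Delta_{q}f(z)$ and $\frac{\Delta_{q}f(z)}{f(z)}$ have infinitely many poles. (2) If $A(z)=-(q-1)z\, s(z)^{2}$, where $s(z)$ is a non-constant rational function, then $\Delta_{q}f(z)$ and $\frac{\Delta_{q}f(z)}{f(z)}$ have infinitely many zeros.
   Context: "Meromorphic" means meromorphic in the whole complex plane $\mathbb{C}$; transcendental means not rational. A meromorphic solution of the equation is a meromorphic function $f$ with $1-(q-1)zf(z)\not\equiv 0$ satisfying the equation as an identity of meromorphic functions. *)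

theory Defs
  imports "HOL-Complex_Analysis.Complex_Analysis" "HOL-Computational_Algebra.Polynomial"
begin

(* A meromorphic function is represented by a total function complex => complex whose values
   on a sparse (closed discrete) set are irrelevant.  Hence identities between meromorphic
   functions are stated as holding at all points outside a sparse set, which also
   makes the convention x / 0 = 0 harmless. *)

definition rational_function :: "(complex \<Rightarrow> complex) \<Rightarrow> bool" where
  "rational_function R \<longleftrightarrow> (\<exists>P Q. Q \<noteq> 0 \<and> (\<forall>\<^sub>\<approx>z. R z = poly P z / poly Q z))"

definition nonconstant :: "(complex \<Rightarrow> complex) \<Rightarrow> bool" where
  "nonconstant R \<longleftrightarrow> \<not> (\<exists>c. \<forall>\<^sub>\<approx>z. R z = c)"

definition transcendental_meromorphic :: "(complex \<Rightarrow> complex) \<Rightarrow> bool" where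
  "transcendental_meromorphic f \<longleftrightarrow> f meromorphic_on UNIV \<and> \<not> rational_function f"

definition q_Riccati_solution ::
  "complex \<Rightarrow> (complex \<Rightarrow> complex) \<Rightarrow> (complex \<Rightarrow> complex) \<Rightarrow> bool" where
  "q_Riccati_solution q A f \<longleftrightarrow>
     f meromorphic_on UNIV \<and>
     \<not> (\<forall>\<^sub>\<approx>z. 1 - (q - 1) * z * f z = 0) \<and>
     (\<forall>\<^sub>\<approx>z. f (q * z) = (A z + f z) / (1 - (q - 1) * z * f z))"

definition q_difference :: "complex \<Rightarrow> (complex \<Rightarrow> complex) \<Rightarrow> complex \<Rightarrow> complex" where
  "q_difference q f z = (f (q * z) - f z) / ((q - 1) * z)"

(* is_pole and isolated_zero depend only on the values of g in a punctured neighbourhood,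
   so these sets are invariant under changing g on a sparse set.  An isolated zero of a
   meromorphic function is exactly a zero of finite positive order; the identically zero
   function has none. *)

definition poles :: "(complex \<Rightarrow> complex) \<Rightarrow> complex set" where
  "poles g = {z. is_pole g z}"

definition zeros :: "(complex \<Rightarrow> complex) \<Rightarrow> complex set" where
  "zeros g = {z. isolated_zero g z}"

end

theory Submission
  imports Defs
begin

text \<open>
  Great Picard at infinity replaces Nevanlinna theory: a meromorphic function on the plane that has
  no poles, zeros and 1-points near infinity is rational.  Put \<open>u = 1 - (q - 1) z f\<close>.  If
  \<open>\<Delta>\<^sub>q f\<close> had finitely many poles, then near infinity \<open>f\<close> would have no poles and \<open>u\<close> no zeros;
  since \<open>u (q z) = 0\<close> amounts to \<open>u z = k z\<close> for a rational \<open>k\<close>, the function \<open>u / k\<close> would omit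
  \<open>0\<close>, \<open>1\<close> and \<open>\<infinity>\<close>.  For \<open>\<Delta>\<^sub>q f / f\<close> the omitted values are those of \<open>(q - 1) z f\<close>.
  In the second part finitely many zeros mean that \<open>f\<close> avoids \<open>s\<close> and \<open>- s\<close>.  The Riccati map sends
  \<open>\<plusminus> s z\<close> to \<open>\<plusminus> s z\<close>, so \<open>f (q z)\<close> avoids \<open>s z\<close>, \<open>- s z\<close> and \<open>s (q z)\<close>, and a cross ratio
  again omits three values.  These three functions are distinct, as a rational function with
  \<open>s (q z) = \<plusminus> s z\<close> is constant when \<open>|q| \<noteq> 1\<close>.
\<close>

subsection \<open>Rational functions and Picard's theorem at infinity\<close>

lemma tendsto_eventually_eq:
  "(f \<longlongrightarrow> l) F \<Longrightarrow> \<forall>\<^sub>F x in F. g x = f x \<Longrightarrow> (g \<longlongrightarrow> l) F"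
  using tendsto_cong[of g f F l] by simp

section \<open>Field operations on rational functions\<close>

lemma rational_functionI:
  "\<forall>\<^sub>\<approx>z. R z = poly P z / poly Q z \<Longrightarrow> Q \<noteq> 0 \<Longrightarrow> rational_function R"
  unfolding rational_function_def by blast

lemma rational_function_cong:
  assumes "rational_function R" "\<forall>\<^sub>\<approx>z. S z = R z"
  shows "rational_function S"
proof -
  obtain P Q where "Q \<noteq> 0" "\<forall>\<^sub>\<approx>z. R z = poly P z / poly Q z"
    using assms(1) unfolding rational_function_def by blast
  from this(2) assms(2) have "\<forall>\<^sub>\<approx>z. S z = poly P z / poly Q z"
    by eventually_elim simp
  then show ?thesis using \<open>Q \<noteq> 0\<close> by (rule rational_functionI)
qed

lemma rational_function_poly: "rational_function (poly P)"
  by (rule rational_functionI[of _ P 1]) auto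

lemma rational_function_const: "rational_function (\<lambda>z. c)"
  using rational_function_poly[of "[:c:]"] by (rule rational_function_cong) simp

lemma rational_function_ident: "rational_function (\<lambda>z. z)"
  using rational_function_poly[of "[:0, 1:]"] by (rule rational_function_cong) simp

lemma eventually_cosparse_poly_nonzero:
  fixes P :: "complex poly"
  assumes "P \<noteq> 0"
  shows "\<forall>\<^sub>\<approx>z. poly P z \<noteq> 0"
proof -
  have "finite {z. poly P z = 0}"
    using assms by (rule poly_roots_finite)
  then show ?thesis
    by (simp add: eventually_cosparse finite_imp_sparse)
qed

lemma rational_function_add:
  assumes "rational_function R" "rational_function S"
  shows "rational_function (\<lambda>z. R z + S z)"
proof -
  obtain P Q P' Q' where Q: "Q \<noteq> 0" "\<forall>\<^sub>\<approx>z. R z = poly P z / poly Q z"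
     "Q' \<noteq> 0" "\<forall>\<^sub>\<approx>z. S z = poly P' z / poly Q' z"
    using assms unfolding rational_function_def by blast
  have "\<forall>\<^sub>\<approx>z. R z + S z = poly (P * Q' + P' * Q) z / poly (Q * Q') z"
    using Q(2,4) eventually_cosparse_poly_nonzero[OF Q(1)] eventually_cosparse_poly_nonzero[OF Q(3)]
    by eventually_elim (simp add: add_frac_eq)
  then show ?thesis by (rule rational_functionI) (use Q in simp)
qed

lemma rational_function_mult:
  assumes "rational_function R" "rational_function S"
  shows "rational_function (\<lambda>z. R z * S z)"
proof -
  obtain P Q P' Q' where Q: "Q \<noteq> 0" "\<forall>\<^sub>\<approx>z. R z = poly P z / poly Q z"
     "Q' \<noteq> 0" "\<forall>\<^sub>\<approx>z. S z = poly P' z / poly Q' z"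
    using assms unfolding rational_function_def by blast
  have "\<forall>\<^sub>\<approx>z. R z * S z = poly (P * P') z / poly (Q * Q') z"
    using Q(2,4) by eventually_elim simp
  then show ?thesis by (rule rational_functionI) (use Q in simp)
qed

lemma rational_function_inverse:
  assumes "rational_function R"
  shows "rational_function (\<lambda>z. inverse (R z))"
proof -
  obtain P Q where Q: "Q \<noteq> 0" "\<forall>\<^sub>\<approx>z. R z = poly P z / poly Q z"
    using assms unfolding rational_function_def by blast
  show ?thesis
  proof (cases "P = 0")
    case True
    \<comment> \<open>By the convention \<open>inverse 0 = 0\<close> the zero function is its own
      reciprocal.\<close>
    have "\<forall>\<^sub>\<approx>z. inverse (R z) = poly 0 z / poly 1 z"
      using Q(2) by eventually_elim (simp add: True)
    then show ?thesis by (rule rational_functionI) simp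
  next
    case False
    have "\<forall>\<^sub>\<approx>z. inverse (R z) = poly Q z / poly P z"
      using Q(2) by eventually_elim simp
    then show ?thesis by (rule rational_functionI) fact
  qed
qed

lemma rational_function_uminus:
  "rational_function R \<Longrightarrow> rational_function (\<lambda>z. - R z)"
  using rational_function_mult[OF rational_function_const[of "-1"]] by fastforce

lemma rational_function_diff:
  "rational_function R \<Longrightarrow> rational_function S \<Longrightarrow> rational_function (\<lambda>z. R z - S z)"
  using rational_function_add[OF _ rational_function_uminus] by fastforce

lemma rational_function_divide:
  "rational_function R \<Longrightarrow> rational_function S \<Longrightarrow> rational_function (\<lambda>z. R z / S z)"
  using rational_function_mult[OF _ rational_function_inverse] by (fastforce simp: field_simps)

lemmas rational_function_intros =
  rational_function_const rational_function_ident rational_function_add rational_function_diff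
  rational_function_uminus rational_function_mult rational_function_inverse rational_function_divide

text \<open>On the whole plane, holding off a sparse set means holding in a punctured neighbourhood
  of every point, and multiplication by \<open>c\<close> carries punctured neighbourhoods of
  \<open>x\<close> to those of \<open>c * x\<close>.\<close>

lemma eventually_cosparse_scale:
  fixes c :: complex
  assumes "c \<noteq> 0" "\<forall>\<^sub>\<approx>z. P z"
  shows "\<forall>\<^sub>\<approx>z. P (c * z)"
  unfolding eventually_cosparse_open_eq[OF open_UNIV]
proof
  fix x
  have "filterlim (\<lambda>z. c * z) (at (c * x)) (at x)"
    using assms(1) by (auto intro!: filterlim_atI tendsto_intros simp: eventually_at_filter)
  moreover have "eventually P (at (c * x))"
    using assms(2) by (simp add: eventually_cosparse_open_eq)
  ultimately show "\<forall>\<^sub>F z in at x. P (c * z)"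
    by (simp add: filterlim_iff)
qed

lemma rational_function_scale:
  assumes "rational_function R" "c \<noteq> 0"
  shows "rational_function (\<lambda>z. R (c * z))"
proof -
  obtain P Q where Q: "Q \<noteq> 0" "\<forall>\<^sub>\<approx>z. R z = poly P z / poly Q z"
    using assms unfolding rational_function_def by blast
  have "\<forall>\<^sub>\<approx>z. R (c * z) = poly (pcompose P [:0, c:]) z / poly (pcompose Q [:0, c:]) z"
    using eventually_cosparse_scale[OF assms(2) Q(2)]
    by eventually_elim (simp add: poly_pcompose mult.commute)
  then show ?thesis
    by (rule rational_functionI) (use Q assms(2) in \<open>simp add: pcompose_eq_0_iff\<close>)
qed

section \<open>Limits of rational functions at points near infinity\<close>

lemma eventually_at_infinity_not_if_finite:
  fixes P :: "complex \<Rightarrow> bool"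
  assumes "finite {z. P z}"
  shows "\<forall>\<^sub>F z in at_infinity. \<not> P z"
proof -
  obtain b where "\<And>z. P z \<Longrightarrow> norm z \<le> b"
    using finite_imp_bounded[OF assms] unfolding bounded_iff by blast
  then show ?thesis
    unfolding eventually_at_infinity by (intro exI[of _ "b + 1"]) force
qed

lemma eventually_at_infinity_poly_nonzero:
  fixes P :: "complex poly"
  assumes "P \<noteq> 0"
  shows "\<forall>\<^sub>F z in at_infinity. poly P z \<noteq> 0"
  using eventually_at_infinity_not_if_finite[OF poly_roots_finite[OF assms]] .

text \<open>Far out the denominator has no roots. Here \<open>at_infinity\<close> ranges over the
  points \<open>a\<close> themselves; a limit at \<open>a\<close> replaces the value
  \<open>R a\<close>, which is not determined by an identity off a sparse set.\<close>

lemma rational_function_tendsto: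
  assumes "rational_function R"
  shows "\<forall>\<^sub>F a in at_infinity. \<exists>l. (R \<longlongrightarrow> l) (at a)"
proof -
  obtain P Q where Q: "Q \<noteq> 0" "\<forall>\<^sub>\<approx>z. R z = poly P z / poly Q z"
    using assms unfolding rational_function_def by blast
  show ?thesis
    using eventually_at_infinity_poly_nonzero[OF Q(1)]
  proof eventually_elim
    case (elim a)
    have "((\<lambda>z. poly P z / poly Q z) \<longlongrightarrow> poly P a / poly Q a) (at a)"
      using elim by (intro tendsto_intros)
    moreover have "\<forall>\<^sub>F z in at a. R z = poly P z / poly Q z"
      using Q(2) by (simp add: eventually_cosparse_open_eq)
    ultimately have "(R \<longlongrightarrow> poly P a / poly Q a) (at a)"
      by (rule tendsto_eventually_eq)
    then show ?case by blast
  qed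
qed

lemma rational_function_tendsto_nonzero:
  assumes "rational_function R" "\<not> (\<forall>\<^sub>\<approx>z. R z = 0)"
  shows "\<forall>\<^sub>F a in at_infinity. \<exists>l. (R \<longlongrightarrow> l) (at a) \<and> l \<noteq> 0"
proof -
  obtain P Q where Q: "Q \<noteq> 0" "\<forall>\<^sub>\<approx>z. R z = poly P z / poly Q z"
    using assms unfolding rational_function_def by blast
  have "P \<noteq> 0" using Q(2) assms(2) by auto
  show ?thesis
    using eventually_at_infinity_poly_nonzero[OF Q(1)]
      eventually_at_infinity_poly_nonzero[OF \<open>P \<noteq> 0\<close>]
  proof eventually_elim
    case (elim a)
    have "((\<lambda>z. poly P z / poly Q z) \<longlongrightarrow> poly P a / poly Q a) (at a)"
      using elim by (intro tendsto_intros)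
    moreover have "\<forall>\<^sub>F z in at a. R z = poly P z / poly Q z"
      using Q(2) by (simp add: eventually_cosparse_open_eq)
    ultimately have "(R \<longlongrightarrow> poly P a / poly Q a) (at a)"
      by (rule tendsto_eventually_eq)
    moreover have "poly P a / poly Q a \<noteq> 0" using elim by simp
    ultimately show ?case by blast
  qed
qed

lemma rational_function_meromorphic:
  assumes "rational_function R"
  shows "R meromorphic_on UNIV"
proof -
  obtain P Q where Q: "Q \<noteq> 0" "\<forall>\<^sub>\<approx>z. R z = poly P z / poly Q z"
    using assms unfolding rational_function_def by blast
  have "(\<lambda>z. poly P z / poly Q z) meromorphic_on UNIV"
    by (intro meromorphic_intros analytic_on_imp_meromorphic_on)
       (auto intro!: holomorphic_intros simp: analytic_on_open)
  then show ?thesis using meromorphic_on_cong'[OF Q(2) refl] by blast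
qed

section \<open>Rationality from the behaviour at infinity and great Picard\<close>

text \<open>With \<open>n\<close> the order of the pole, the product agrees near \<open>p\<close>
  with the holomorphic function \<open>zor_poly f p\<close> and so has a finite limit at
  \<open>p\<close>.\<close>

lemma meromorphic_mult_power_not_pole:
  assumes "f meromorphic_on UNIV"
  shows "\<exists>n. \<not> is_pole (\<lambda>w. (w - p) ^ n * f w) p"
proof (cases "is_pole f p")
  case False
  then show ?thesis by (intro exI[of _ 0]) simp
next
  case True
  obtain r where r: "r > 0" "f analytic_on ball p r - {p}"
    using assms by (auto simp: meromorphic_on_altdef isolated_singularity_at_def)
  obtain d where d: "0 < d" "cball p d \<subseteq> ball p r" "zor_poly f p holomorphic_on cball p d"
      "\<forall>w\<in>cball p d - {p}. f w = zor_poly f p w / (w - p) ^ nat (- zorder f p)"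
    using zorder_exist_pole[of f "ball p r" p] r True analytic_imp_holomorphic by auto
  have "isCont (zor_poly f p) p"
    using d(1,3) by (meson ball_subset_cball centre_in_ball continuous_on_eq_continuous_at
        holomorphic_on_imp_continuous_on holomorphic_on_subset open_ball)
  then have "zor_poly f p \<midarrow>p\<rightarrow> zor_poly f p p"
    by (simp add: isCont_def)
  moreover have "\<forall>\<^sub>F w in at p. zor_poly f p w = (w - p) ^ nat (- zorder f p) * f w"
  proof -
    have "\<forall>\<^sub>F w in at p. w \<in> ball p d - {p}"
      using d(1) by (intro eventually_at_in_open) auto
    then show ?thesis by eventually_elim (use d(4) in auto)
  qed
  ultimately have "(\<lambda>w. (w - p) ^ nat (- zorder f p) * f w) \<midarrow>p\<rightarrow> zor_poly f p p"
    by (rule Lim_transform_eventually)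
  then show ?thesis
    unfolding is_pole_def using not_tendsto_and_filterlim_at_infinity[OF at_neq_bot] by blast
qed

text \<open>Poles are removed one at a time: a power of \<open>w - p\<close> cancels the pole at
  \<open>p\<close> and, being analytic and nonzero elsewhere, affects no other pole.\<close>

lemma meromorphic_clear_poles:
  assumes "finite S" "f meromorphic_on UNIV" "{z. is_pole f z} \<subseteq> S"
  shows "\<exists>P. P \<noteq> 0 \<and> (\<forall>z. \<not> is_pole (\<lambda>w. poly P w * f w) z)"
  using assms
proof (induction S arbitrary: f rule: finite_induct)
  case empty
  then show ?case by (intro exI[of _ 1]) auto
next
  case (insert p S)
  obtain n where n: "\<not> is_pole (\<lambda>w. (w - p) ^ n * f w) p"
    using meromorphic_mult_power_not_pole[OF insert.prems(1)] by blast
  define h where "h = (\<lambda>w. (w - p) ^ n * f w)"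
  have h: "h meromorphic_on UNIV"
    unfolding h_def by (intro meromorphic_intros insert.prems)
  have "is_pole h z \<longleftrightarrow> is_pole f z" if "z \<noteq> p" for z
    unfolding h_def using that
    by (intro is_pole_mult_analytic_nonzero1_iff) (auto intro!: analytic_intros)
  then have "{z. is_pole h z} \<subseteq> S"
    using insert.prems(2) n unfolding h_def by (metis (no_types, lifting) insertE mem_Collect_eq subset_iff)
  then obtain P where P: "P \<noteq> 0" "\<And>z. \<not> is_pole (\<lambda>w. poly P w * h w) z"
    using insert.IH[OF h] by blast
  then show ?case
    by (intro exI[of _ "P * [:- p, 1:] ^ n"])
       (simp add: h_def mult.assoc)
qed

text \<open>Multiplying by a polynomial \<open>P\<close> turns \<open>f\<close> into an entire
  function \<open>H\<close> whose reciprocal still has a limit at infinity. Such an \<open>H\<close>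
  is a polynomial, and \<open>f = H / P\<close>.\<close>

lemma rational_function_if_inverse_tendsto:
  assumes f: "f meromorphic_on UNIV" and fin: "finite {z. is_pole f z}"
    and lim: "((\<lambda>z. inverse (f z)) \<longlongrightarrow> l) at_infinity"
    and an: "\<forall>\<^sub>F z in at_infinity. f analytic_on {z}"
  shows "rational_function f"
proof -
  obtain P where P: "P \<noteq> 0" "\<And>z. \<not> is_pole (\<lambda>w. poly P w * f w) z"
    using meromorphic_clear_poles[OF fin f subset_refl] by blast
  define h where "h = (\<lambda>w. poly P w * f w)"
  define H where "H = remove_sings h"
  have mero: "h meromorphic_on UNIV"
    unfolding h_def
    by (intro meromorphic_on_mult f rational_function_meromorphic rational_function_poly)
  have H: "\<forall>\<^sub>\<approx>z. H z = h z"
    unfolding H_def by (rule eventually_remove_sings_eq) fact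
  have "\<not> is_pole H z" for z
    using P(2)[of z] H is_pole_cong[of H h z z] unfolding h_def
    by (simp add: eventually_cosparse_open_eq)
  then have "H analytic_on UNIV"
    unfolding H_def using remove_sings_nicely_meromorphic[OF mero]
    by (intro nicely_meromorphic_without_singularities) auto
  then have hol: "H holomorphic_on UNIV" by (rule analytic_imp_holomorphic)
  \<comment> \<open>The reciprocal of \<open>P\<close> tends to 0 at infinity unless
    \<open>P\<close> is constant, whence the case distinction in the limit.\<close>
  have lim_H: "((inverse o H) \<longlongrightarrow> (if degree P = 0 then inverse (coeff P 0) else 0) * l) at_infinity"
  proof -
    have "((\<lambda>z. inverse (poly P z)) \<longlongrightarrow> (if degree P = 0 then inverse (coeff P 0) else 0)) at_infinity"
    proof (cases "degree P = 0")
      case True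
      then obtain c where "P = [:c:]" by (auto elim: degree_eq_zeroE)
      then show ?thesis by simp
    next
      case False
      then have "filterlim (poly P) at_infinity at_infinity"
        by (intro filterlim_poly_at_infinity) auto
      then show ?thesis
        using False by (simp add: filterlim_compose[OF tendsto_inverse_0])
    qed
    then have "((\<lambda>z. inverse (poly P z) * inverse (f z)) \<longlongrightarrow>
        (if degree P = 0 then inverse (coeff P 0) else 0) * l) at_infinity"
      by (rule tendsto_mult[OF _ lim])
    \<comment> \<open>A limit at infinity sees every value, so equality off a sparse set does not
      suffice. Where \<open>f\<close> is analytic, so is \<open>h\<close>, and
      \<open>remove_sings\<close> leaves its value unchanged.\<close>
    moreover have "\<forall>\<^sub>F z in at_infinity. inverse (poly P z) * inverse (f z) = (inverse o H) z"
      using an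
    proof eventually_elim
      case (elim z)
      have "poly P holomorphic_on UNIV" by (intro holomorphic_intros)
      then have "poly P analytic_on {z}" by (rule holomorphic_on_imp_analytic_at) auto
      then have "h analytic_on {z}"
        unfolding h_def using elim by (rule analytic_on_mult)
      then have "H z = h z"
        unfolding H_def by (rule remove_sings_at_analytic)
      then show ?case by (simp add: h_def)
    qed
    ultimately show ?thesis by (rule Lim_transform_eventually)
  qed
  obtain a n where a: "\<And>z. H z = (\<Sum>i\<le>n. a i * z ^ i)"
    using pole_at_infinity[OF hol lim_H] by blast
  have "\<forall>\<^sub>\<approx>z. f z = poly (\<Sum>i\<le>n. monom (a i) i) z / poly P z"
    using H eventually_cosparse_poly_nonzero[OF P(1)]
    by eventually_elim (simp add: a h_def poly_sum poly_monom)
  then show ?thesis using P(1) by (rule rational_functionI)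
qed

text \<open>After removal of singularities, \<open>g (inverse w)\<close> is holomorphic near 0
  except at 0 and omits 0 and 1 there. By great Picard \<open>g\<close> or its reciprocal has a
  finite limit at infinity, and either case reduces to
  \<open>rational_function_if_inverse_tendsto\<close>.\<close>

lemma Picard_rational_function:
  assumes f: "f meromorphic_on UNIV"
    and pole: "\<forall>\<^sub>F z in at_infinity. \<not> is_pole f z"
    and zero: "\<forall>\<^sub>F z in at_infinity. \<not> isolated_zero f z"
    and one: "\<forall>\<^sub>F z in at_infinity. \<not> isolated_zero (\<lambda>w. f w - 1) z"
  shows "rational_function f"
proof (cases "\<exists>c. \<forall>\<^sub>\<approx>z. f z = c")
  case True
  then show ?thesis using rational_function_cong[OF rational_function_const] by blast
next
  case nonconst: False
  define g where "g = remove_sings f"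
  have nice: "g nicely_meromorphic_on UNIV"
    unfolding g_def by (rule remove_sings_nicely_meromorphic) fact
  then have g: "g meromorphic_on UNIV" by (simp add: nicely_meromorphic_on_def)
  have fg: "\<forall>\<^sub>\<approx>z. g z = f z"
    unfolding g_def by (rule eventually_remove_sings_eq) fact
  have fg_at: "\<forall>\<^sub>F w in at z. g w = f w" for z
    using fg by (simp add: eventually_cosparse_open_eq)
  have pole_iff: "is_pole g z \<longleftrightarrow> is_pole f z" for z
    using fg_at by (rule is_pole_cong) simp
  have ne: "\<forall>\<^sub>F w in at z. g w \<noteq> c" for z c
  proof -
    have "\<forall>\<^sub>\<approx>w. f w \<noteq> c"
      using meromorphic_imp_constant_or_avoid[OF f open_UNIV connected_UNIV] nonconst by blast
    with fg have "\<forall>\<^sub>\<approx>w. g w \<noteq> c" by eventually_elim simp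
    then show ?thesis by (simp add: eventually_cosparse_open_eq)
  qed
  \<comment> \<open>Passage from isolated zeros to actual values: away from poles \<open>g z\<close>
    is the limit of \<open>f\<close>, and nonconstancy keeps \<open>f\<close> different from
    \<open>c\<close> near \<open>z\<close>, so \<open>g z = c\<close> would give an isolated zero of
    \<open>f - c\<close>.\<close>
  have avoid: "g z \<noteq> c" if "\<not> is_pole f z" "\<not> isolated_zero (\<lambda>w. f w - c) z" for z c
  proof
    assume "g z = c"
    have "g \<midarrow>z\<rightarrow> g z"
      using nice that(1) by (auto simp: nicely_meromorphic_on_def pole_iff)
    then have "g \<midarrow>z\<rightarrow> c" using \<open>g z = c\<close> by simp
    then have "f \<midarrow>z\<rightarrow> c" using tendsto_cong[OF fg_at] by blast
    then have "(\<lambda>w. f w - c) \<midarrow>z\<rightarrow> 0" by (simp add: LIM_zero)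
    moreover have "\<forall>\<^sub>F w in at z. f w - c \<noteq> 0"
      using ne[of c z] fg_at[of z] by eventually_elim simp
    ultimately show False using that(2) by (simp add: isolated_zero_def)
  qed
  have an: "g analytic_on {z}" if "\<not> is_pole f z" for z
    using nicely_meromorphic_on_imp_analytic_at[OF nice] that pole_iff by simp
  have "\<forall>\<^sub>F z in at_infinity. \<not> is_pole f z \<and> g z \<noteq> 0 \<and> g z \<noteq> 1"
    using pole zero one by eventually_elim (use avoid[of _ 0] avoid[of _ 1] in auto)
  then obtain b where b: "\<And>z. b \<le> norm z \<Longrightarrow> \<not> is_pole f z \<and> g z \<noteq> 0 \<and> g z \<noteq> 1"
    unfolding eventually_at_infinity by blast
  define r where "r = max b 1"
  have r: "r > 0" "b \<le> r" by (auto simp: r_def)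
  have big: "b \<le> norm (inverse w)" if "w \<in> ball 0 (1 / r) - {0}" for w :: complex
  proof -
    have "norm w < 1 / r" "w \<noteq> 0" using that by auto
    then have "r < inverse (norm w)" using r by (simp add: field_simps)
    then show ?thesis using r by (simp add: norm_inverse)
  qed
  have "(\<lambda>w. g (inverse w)) holomorphic_on ball 0 (1 / r) - {0}"
  proof -
    have "g holomorphic_on inverse ` (ball 0 (1 / r) - {0})"
      using an b big by (intro analytic_imp_holomorphic, subst analytic_on_analytic_at) auto
    moreover have "inverse holomorphic_on (ball 0 (1 / r) - {0} :: complex set)"
      by (intro holomorphic_intros) auto
    ultimately show ?thesis
      using holomorphic_on_compose[of inverse _ g] by (simp add: o_def)
  qed
  moreover have "g (inverse w) \<noteq> 0 \<and> g (inverse w) \<noteq> 1" if "w \<in> ball 0 (1 / r) - {0}" for w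
    using b big[OF that] by blast
  ultimately obtain l where l: "((\<lambda>w. g (inverse w)) \<longlongrightarrow> l) (at 0) \<or>
      ((inverse \<circ> (\<lambda>w. g (inverse w))) \<longlongrightarrow> l) (at 0)"
    using great_Picard[of "ball 0 (1 / r)" 0 0 1 "\<lambda>w. g (inverse w)"] r(1)
    by (smt (verit) open_ball centre_in_ball zero_neq_one zero_less_divide_1_iff)
  \<comment> \<open>The poles form a sparse set inside a compact disc.\<close>
  have fin: "finite {z. is_pole g z}"
  proof -
    have "{z. is_pole g z} sparse_in UNIV"
      using meromorphic_on_imp_not_pole_cosparse[OF g] by (simp add: eventually_cosparse)
    then have "{z. is_pole g z} sparse_in cball 0 r"
      by (rule sparse_in_subset) simp
    then have "finite (cball 0 r \<inter> {z. is_pole g z})"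
      by (rule sparse_in_compact_finite) simp
    moreover have "{z. is_pole g z} \<subseteq> cball 0 r"
      using b r by (force simp: pole_iff)
    ultimately show ?thesis by (simp add: Int_absorb1)
  qed
  have an_inf: "\<forall>\<^sub>F z in at_infinity. g analytic_on {z}"
    using pole by eventually_elim (rule an)
  have "rational_function g"
    using l
  proof
    assume "((inverse \<circ> (\<lambda>w. g (inverse w))) \<longlongrightarrow> l) (at 0)"
    then have "((\<lambda>z. inverse (g z)) \<longlongrightarrow> l) at_infinity"
      by (simp add: lim_at_infinity_0 o_def)
    then show ?thesis
      using rational_function_if_inverse_tendsto g fin an_inf by blast
  next
    assume "((\<lambda>w. g (inverse w)) \<longlongrightarrow> l) (at 0)"
    then have "(g \<longlongrightarrow> l) at_infinity"
      by (simp add: lim_at_infinity_0 o_def)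
    \<comment> \<open>The shift by \<open>1 - l\<close> moves the limit to 1, so that the reciprocal
      converges even when \<open>l = 0\<close>.\<close>
    then have "((\<lambda>z. inverse (g z + (1 - l))) \<longlongrightarrow> inverse (l + (1 - l))) at_infinity"
      by (intro tendsto_intros) auto
    moreover have "(\<lambda>z. g z + (1 - l)) meromorphic_on UNIV"
      by (intro meromorphic_intros g)
    moreover have "finite {z. is_pole (\<lambda>z. g z + (1 - l)) z}"
      using fin is_pole_plus_const_iff[of g _ "1 - l"] by simp
    moreover have "\<forall>\<^sub>F z in at_infinity. (\<lambda>z. g z + (1 - l)) analytic_on {z}"
      using an_inf by eventually_elim (auto intro!: analytic_intros)
    ultimately have "rational_function (\<lambda>z. g z + (1 - l))"
      using rational_function_if_inverse_tendsto by blast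
    from rational_function_diff[OF this rational_function_const[of "1 - l"]]
    show ?thesis by simp
  qed
  moreover have "\<forall>\<^sub>\<approx>z. f z = g z" using fg by eventually_elim simp
  ultimately show ?thesis by (rule rational_function_cong)
qed

section \<open>Rational functions invariant under a scaling\<close>

text \<open>\<open>R\<close> takes a single value \<open>v\<close> along an orbit
  \<open>c ^ n * z\<close>. The orbit is infinite, so the polynomial \<open>P - v Q\<close> has
  infinitely many roots and vanishes.\<close>

lemma rational_function_scale_invariant_expanding:
  assumes "rational_function R" "cmod c > 1" "\<forall>\<^sub>\<approx>z. R (c * z) = R z"
  shows "\<exists>v. \<forall>\<^sub>\<approx>z. R z = v"
proof -
  obtain P Q where Q: "Q \<noteq> 0" "\<forall>\<^sub>\<approx>z. R z = poly P z / poly Q z"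
    using assms unfolding rational_function_def by blast
  have "c \<noteq> 0" using assms(2) by auto
  \<comment> \<open>\<open>D\<close> is the numerator of \<open>R (c * z) - R z\<close>. As a
    polynomial vanishing off a sparse set it is zero, which upgrades the invariance to an identity
    at every point.\<close>
  define D where "D = pcompose P [:0, c:] * Q - P * pcompose Q [:0, c:]"
  have Q': "\<forall>\<^sub>\<approx>z. poly Q (c * z) \<noteq> 0" "\<forall>\<^sub>\<approx>z. R (c * z) = poly P (c * z) / poly Q (c * z)"
    using eventually_cosparse_scale[OF \<open>c \<noteq> 0\<close>] eventually_cosparse_poly_nonzero[OF Q(1)] Q(2)
    by blast+
  have "\<forall>\<^sub>\<approx>z. poly D z = 0"
    using assms(3) Q(2) Q' eventually_cosparse_poly_nonzero[OF Q(1)]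
    by eventually_elim (simp add: D_def poly_pcompose frac_eq_eq mult.commute)
  then have "\<forall>\<^sub>\<approx>z::complex. False" if "D \<noteq> 0"
    using eventually_cosparse_poly_nonzero[OF that] by eventually_elim simp
  then have "D = 0" by (auto simp: eventually_False)
  then have step: "poly P (c * z) * poly Q z = poly P z * poly Q (c * z)" for z
  proof -
    have "poly D z = 0" using \<open>D = 0\<close> by simp
    then show ?thesis by (simp add: D_def poly_pcompose mult.commute)
  qed
  obtain b where b: "\<And>z. b \<le> norm z \<Longrightarrow> poly Q z \<noteq> 0"
    using eventually_at_infinity_poly_nonzero[OF Q(1)] unfolding eventually_at_infinity by blast
  \<comment> \<open>The starting point lies beyond all roots of \<open>Q\<close>, and its orbit only
    moves outwards. The bound 1 makes it nonzero, so that the orbit is infinite.\<close>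
  define z where "z = (of_real (max b 1) :: complex)"
  have z: "norm z \<ge> b" "norm z \<ge> 1" by (auto simp: z_def)
  have Qz: "poly Q (c ^ n * z) \<noteq> 0" for n
  proof (rule b)
    have "norm z \<le> norm (c ^ n * z)"
      using assms(2) by (simp add: norm_mult norm_power mult_le_cancel_right1)
    then show "b \<le> norm (c ^ n * z)" using z by simp
  qed
  define v where "v = poly P z / poly Q z"
  have root: "poly P (c ^ n * z) = v * poly Q (c ^ n * z)" for n
  proof (induction n)
    case 0
    then show ?case using Qz[of 0] by (simp add: v_def)
  next
    case (Suc n)
    have "poly P (c ^ Suc n * z) * poly Q (c ^ n * z) = v * poly Q (c ^ Suc n * z) * poly Q (c ^ n * z)"
      using step[of "c ^ n * z"] Suc by (simp add: mult.assoc mult.left_commute)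
    then show ?case using Qz[of n] by simp
  qed
  have "inj (\<lambda>n. c ^ n * z)"
  proof (rule injI)
    fix m n assume "c ^ m * z = c ^ n * z"
    moreover have "z \<noteq> 0" using z by auto
    ultimately have "cmod c ^ m = cmod c ^ n" by (simp flip: norm_power)
    then show "m = n" using assms(2) by simp
  qed
  then have "infinite (range (\<lambda>n. c ^ n * z))" by (rule range_inj_infinite)
  moreover have "range (\<lambda>n. c ^ n * z) \<subseteq> {w. poly (P - smult v Q) w = 0}"
    using root by auto
  ultimately have "P - smult v Q = 0"
    using poly_roots_finite finite_subset by blast
  then have P: "P = smult v Q" by simp
  have "\<forall>\<^sub>\<approx>z. R z = v"
    using Q(2) eventually_cosparse_poly_nonzero[OF Q(1)] by eventually_elim (simp add: P)
  then show ?thesis by blast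
qed

text \<open>A contraction is treated through its inverse, under which \<open>R\<close> is invariant
  as well.\<close>

lemma rational_function_scale_invariant:
  assumes "rational_function R" "c \<noteq> 0" "cmod c \<noteq> 1" "\<forall>\<^sub>\<approx>z. R (c * z) = R z"
  shows "\<exists>v. \<forall>\<^sub>\<approx>z. R z = v"
proof (cases "cmod c > 1")
  case True
  then show ?thesis using rational_function_scale_invariant_expanding assms by blast
next
  case False
  have "inverse c \<noteq> 0" using assms(2) by simp
  from eventually_cosparse_scale[OF this assms(4)]
  have "\<forall>\<^sub>\<approx>z. R (inverse c * z) = R z"
    by eventually_elim (simp add: assms(2) flip: mult.assoc)
  moreover have "cmod (inverse c) > 1"
    using False assms(2,3) by (simp add: norm_inverse one_less_inverse_iff)
  ultimately show ?thesis using rational_function_scale_invariant_expanding assms(1) by blast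
qed

section \<open>Transport of zeros and poles along scalings and nonvanishing factors\<close>

lemma filterlim_scale_at:
  fixes c :: complex
  assumes "c \<noteq> 0"
  shows "filterlim (\<lambda>z. c * z) (at (c * a)) (at a)"
  using assms by (auto intro!: filterlim_atI tendsto_intros simp: eventually_at_filter)

lemma eventually_at_infinity_scale:
  fixes c :: complex
  assumes "c \<noteq> 0" "\<forall>\<^sub>F z in at_infinity. P z"
  shows "\<forall>\<^sub>F z in at_infinity. P (c * z)"
proof -
  have "filterlim (\<lambda>z. c * z) at_infinity at_infinity"
    using assms(1) by (intro tendsto_mult_filterlim_at_infinity[of _ c]) (auto intro: filterlim_ident)
  with assms(2) show ?thesis by (simp add: filterlim_iff)
qed

lemma isolated_zero_scale:
  fixes f :: "complex \<Rightarrow> complex"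
  assumes "c \<noteq> 0" "isolated_zero (\<lambda>z. f (c * z)) a"
  shows "isolated_zero f (c * a)"
proof -
  have "filterlim (\<lambda>z. inverse c * z) (at (inverse c * (c * a))) (at (c * a))"
    using assms(1) by (intro filterlim_scale_at) auto
  then have lim: "filterlim (\<lambda>z. inverse c * z) (at a) (at (c * a))"
    using assms(1) by (simp flip: mult.assoc)
  have "((\<lambda>z. f (c * (inverse c * z))) \<longlongrightarrow> 0) (at (c * a))"
    using assms(2) by (intro filterlim_compose[OF _ lim, where g = "\<lambda>z. f (c * z)"])
      (simp add: isolated_zero_def)
  moreover have "\<forall>\<^sub>F z in at (c * a). f (c * (inverse c * z)) \<noteq> 0"
    using assms(2) by (intro eventually_compose_filterlim[OF _ lim]) (simp add: isolated_zero_def)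
  ultimately show ?thesis
    using assms(1) by (simp add: isolated_zero_def flip: mult.assoc)
qed

lemma is_pole_scale:
  fixes f :: "complex \<Rightarrow> complex"
  assumes "c \<noteq> 0" "is_pole f (c * a)"
  shows "is_pole (\<lambda>z. f (c * z)) a"
  using assms(2) filterlim_scale_at[OF assms(1)] unfolding is_pole_def by (rule filterlim_compose)

text \<open>The main device for local arguments: a factor with a finite nonzero limit neither
  creates nor destroys a zero. Only an identity near \<open>a\<close> is required, so every use
  reduces to one algebraic identity and one limit.\<close>

lemma isolated_zero_transfer:
  fixes f :: "complex \<Rightarrow> complex"
  assumes "isolated_zero f a" "(g \<longlongrightarrow> c) (at a)" "c \<noteq> 0" "\<forall>\<^sub>F z in at a. h z = f z * g z"
  shows "isolated_zero h a"
proof -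
  have "((\<lambda>z. f z * g z) \<longlongrightarrow> 0 * c) (at a)"
    using assms(1,2) by (intro tendsto_intros) (auto simp: isolated_zero_def)
  then have "(h \<longlongrightarrow> 0) (at a)"
    using assms(4) by (simp add: tendsto_cong)
  have "\<forall>\<^sub>F z in at a. g z \<noteq> 0"
    using assms(2,3) by (rule tendsto_imp_eventually_ne)
  moreover have "\<forall>\<^sub>F z in at a. f z \<noteq> 0"
    using assms(1) by (simp add: isolated_zero_def)
  ultimately have "\<forall>\<^sub>F z in at a. h z \<noteq> 0"
    using assms(4) by eventually_elim simp
  with \<open>(h \<longlongrightarrow> 0) (at a)\<close> show ?thesis by (simp add: isolated_zero_def)
qed

text \<open>The reciprocal of \<open>h\<close> has an isolated zero by
  \<open>isolated_zero_transfer\<close>. The guard \<open>f z \<noteq> 0\<close> lets the identity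
  be proved by dividing by \<open>f z\<close>.\<close>

lemma is_pole_transfer:
  fixes f :: "complex \<Rightarrow> complex"
  assumes "isolated_zero f a" "(g \<longlongrightarrow> c) (at a)" "c \<noteq> 0"
    "\<forall>\<^sub>F z in at a. f z \<noteq> 0 \<longrightarrow> h z = g z / f z"
  shows "is_pole h a"
proof -
  have "isolated_zero (\<lambda>z. inverse (h z)) a"
    using assms(1)
  proof (rule isolated_zero_transfer)
    show "((\<lambda>z. inverse (g z)) \<longlongrightarrow> inverse c) (at a)"
      using assms(2,3) by (rule tendsto_inverse)
    have "\<forall>\<^sub>F z in at a. f z \<noteq> 0"
      using assms(1) by (simp add: isolated_zero_def)
    with assms(4) show "\<forall>\<^sub>F z in at a. inverse (h z) = f z * inverse (g z)"
      by eventually_elim (simp add: divide_inverse)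
  qed (use assms in simp)
  then show ?thesis using isolated_zero_inverse_iff by blast
qed

section \<open>Meromorphic functions omitting three rational functions\<close>

text \<open>The cross ratio \<open>v\<close> sends \<open>s\<close>, \<open>- s\<close> and
  \<open>t\<close> to 0, infinity and 1; the assumptions \<open>ne\<close> say that these three are
  distinct. Picard makes \<open>v\<close> rational, and \<open>g\<close> is recovered from
  \<open>v\<close> by the inverse Moebius map.\<close>

lemma rational_if_omits_three:
  assumes g: "g meromorphic_on UNIV" and s: "rational_function s" and t: "rational_function t"
    and ne: "\<not> (\<forall>\<^sub>\<approx>z. s z = 0)" "\<not> (\<forall>\<^sub>\<approx>z. t z - s z = 0)" "\<not> (\<forall>\<^sub>\<approx>z. t z + s z = 0)"
    and omits: "\<forall>\<^sub>F a in at_infinity. \<not> isolated_zero (\<lambda>z. g z - s z) a"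
      "\<forall>\<^sub>F a in at_infinity. \<not> isolated_zero (\<lambda>z. g z + s z) a"
      "\<forall>\<^sub>F a in at_infinity. \<not> isolated_zero (\<lambda>z. g z - t z) a"
  shows "rational_function g"
proof (cases "\<forall>\<^sub>\<approx>z. g z + s z = 0")
  \<comment> \<open>The denominator of the cross ratio would vanish identically, but then
    \<open>g = - s\<close> is already rational.\<close>
  case True
  have "rational_function (\<lambda>z. - s z)" using s by (rule rational_function_uminus)
  moreover have "\<forall>\<^sub>\<approx>z. g z = - s z"
    using True by eventually_elim (simp add: eq_neg_iff_add_eq_0)
  ultimately show ?thesis by (rule rational_function_cong)
next
  case False
  define \<kappa> where "\<kappa> = (\<lambda>z. (t z - s z) / (t z + s z))"
  define v where "v = (\<lambda>z. (g z - s z) / (g z + s z) / \<kappa> z)"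
  note mero = g rational_function_meromorphic[OF s] rational_function_meromorphic[OF t]
  have avoid: "\<forall>\<^sub>\<approx>z. h z \<noteq> 0" if "h meromorphic_on UNIV" "\<not> (\<forall>\<^sub>\<approx>z. h z = 0)" for h
    using meromorphic_imp_constant_or_avoid[OF that(1), of 0] that(2) by auto
  from avoid[OF mero(2) ne(1)] avoid[OF meromorphic_on_diff[OF mero(3,2)] ne(2)]
    avoid[OF meromorphic_on_add[OF mero(3,2)] ne(3)] avoid[OF meromorphic_on_add[OF mero(1,2)] False]
  \<comment> \<open>Besides the nonvanishing conditions, this expresses the differences of
    \<open>g\<close> from the three targets through \<open>v\<close>, in the product form needed for
    transferring zeros.\<close>
  have nz: "\<forall>\<^sub>\<approx>z. s z \<noteq> 0 \<and> t z + s z \<noteq> 0 \<and> g z + s z \<noteq> 0 \<and> \<kappa> z \<noteq> 0 \<and> 1 - v z * \<kappa> z \<noteq> 0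
      \<and> g z - s z = v z * (\<kappa> z * (2 * s z) / (1 - v z * \<kappa> z))
      \<and> g z - t z = (v z - 1) * (\<kappa> z * (t z + s z) / (1 - v z * \<kappa> z))
      \<and> g z + s z = 2 * s z / (1 - v z * \<kappa> z)"
  proof eventually_elim
    case (elim z)
    define x where "x = g z + s z"
    define y where "y = t z + s z"
    have xy: "x \<noteq> 0" "y \<noteq> 0" "g z = x - s z" "t z = y - s z" "y \<noteq> 2 * s z"
      using elim by (auto simp: x_def y_def algebra_simps)
    have k: "\<kappa> z = (y - 2 * s z) / y" using xy by (simp add: \<kappa>_def)
    have vk: "v z * \<kappa> z = (x - 2 * s z) / x"
      using xy k by (simp add: v_def)
    have r: "1 - v z * \<kappa> z = 2 * s z / x"
      unfolding vk using xy by (simp add: field_simps)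
    have v: "(v z - 1) * \<kappa> z = (x - 2 * s z) / x - (y - 2 * s z) / y"
      unfolding left_diff_distrib mult_1 by (simp only: vk, simp only: k)
    have "v z * (\<kappa> z * (2 * s z) / (1 - v z * \<kappa> z)) = v z * \<kappa> z * (2 * s z / (1 - v z * \<kappa> z))"
      by simp
    also have "\<dots> = x - 2 * s z"
      by (subst r, subst vk) (use xy elim in simp)
    finally have 1: "g z - s z = v z * (\<kappa> z * (2 * s z) / (1 - v z * \<kappa> z))" using xy by simp
    have "(v z - 1) * (\<kappa> z * (t z + s z) / (1 - v z * \<kappa> z)) =
        (v z - 1) * \<kappa> z * (y / (1 - v z * \<kappa> z))" by (simp add: y_def)
    also have "\<dots> = x - y"
      unfolding r v using xy elim by (simp add: field_simps)
    finally have 2: "g z - t z = (v z - 1) * (\<kappa> z * (t z + s z) / (1 - v z * \<kappa> z))" using xy by simp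
    show ?case
      using 1 2 elim r xy k unfolding x_def[symmetric] y_def[symmetric] by simp
  qed
  note nz_at = eventually_cosparse_imp_eventually_at[OF nz UNIV_I]
  have rat_\<kappa>: "rational_function \<kappa>"
    unfolding \<kappa>_def by (intro rational_function_intros s t)
  have "\<forall>\<^sub>F a in at_infinity. \<exists>m. (s \<longlongrightarrow> m) (at a) \<and> m \<noteq> 0"
    using rational_function_tendsto_nonzero[OF s ne(1)] .
  moreover have "\<forall>\<^sub>F a in at_infinity. \<exists>l. ((\<lambda>z. t z - s z) \<longlongrightarrow> l) (at a) \<and> l \<noteq> 0"
    using rational_function_tendsto_nonzero[OF rational_function_diff[OF t s] ne(2)] .
  moreover have "\<forall>\<^sub>F a in at_infinity. \<exists>l. ((\<lambda>z. t z + s z) \<longlongrightarrow> l) (at a) \<and> l \<noteq> 0"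
    using rational_function_tendsto_nonzero[OF rational_function_add[OF t s] ne(3)] .
  \<comment> \<open>If \<open>s\<close> tends to \<open>m\<close> and \<open>t + s\<close> to
    \<open>n\<close>, then \<open>t - s\<close> tends to \<open>n - 2 * m\<close>. Hence
    \<open>\<kappa>\<close> has a finite nonzero limit, which differs from 1 because
    \<open>m \<noteq> 0\<close>.\<close>
  ultimately have lims: "\<forall>\<^sub>F a in at_infinity. \<exists>m n. (s \<longlongrightarrow> m) (at a) \<and> m \<noteq> 0 \<and>
      ((\<lambda>z. t z + s z) \<longlongrightarrow> n) (at a) \<and> n \<noteq> 0 \<and> n - 2 * m \<noteq> 0 \<and> (\<kappa> \<longlongrightarrow> (n - 2 * m) / n) (at a)"
  proof eventually_elim
    case (elim a)
    then obtain m l n where m: "(s \<longlongrightarrow> m) (at a)" "m \<noteq> 0" and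
      l: "((\<lambda>z. t z - s z) \<longlongrightarrow> l) (at a)" "l \<noteq> 0" and
      n: "((\<lambda>z. t z + s z) \<longlongrightarrow> n) (at a)" "n \<noteq> 0" by blast
    have "((\<lambda>z. (t z + s z) - 2 * s z) \<longlongrightarrow> n - 2 * m) (at a)"
      by (intro tendsto_intros m n)
    then have lim: "((\<lambda>z. t z - s z) \<longlongrightarrow> n - 2 * m) (at a)" by (simp add: algebra_simps)
    then have "l = n - 2 * m" using l(1) tendsto_unique[OF at_neq_bot] by blast
    moreover have "(\<kappa> \<longlongrightarrow> (n - 2 * m) / n) (at a)"
      unfolding \<kappa>_def by (intro tendsto_intros lim n)
    ultimately show ?case using m n l by blast
  qed
  have "rational_function v"
  proof (rule Picard_rational_function)
    show "v meromorphic_on UNIV"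
      unfolding v_def by (intro meromorphic_intros mero rational_function_meromorphic[OF rat_\<kappa>])
    show "\<forall>\<^sub>F a in at_infinity. \<not> isolated_zero v a"
      using omits(1) lims
    proof eventually_elim
      case (elim a)
      then obtain m n where m: "(s \<longlongrightarrow> m) (at a)" "m \<noteq> 0" and n: "n \<noteq> 0" "n - 2 * m \<noteq> 0"
        "(\<kappa> \<longlongrightarrow> (n - 2 * m) / n) (at a)" by blast
      show ?case
      proof
        assume v: "isolated_zero v a"
        then have v0: "(v \<longlongrightarrow> 0) (at a)" by (simp add: isolated_zero_def)
        have "isolated_zero (\<lambda>z. g z - s z) a"
          using v
        proof (rule isolated_zero_transfer)
          show "((\<lambda>z. \<kappa> z * (2 * s z) / (1 - v z * \<kappa> z)) \<longlongrightarrow>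
              (n - 2 * m) / n * (2 * m) / (1 - 0 * ((n - 2 * m) / n))) (at a)"
            by (intro tendsto_intros m n v0) simp
          show "(n - 2 * m) / n * (2 * m) / (1 - 0 * ((n - 2 * m) / n)) \<noteq> 0"
            using m n by simp
          show "\<forall>\<^sub>F z in at a. g z - s z = v z * (\<kappa> z * (2 * s z) / (1 - v z * \<kappa> z))"
            using nz_at by eventually_elim blast
        qed
        then show False using elim by blast
      qed
    qed
    show "\<forall>\<^sub>F a in at_infinity. \<not> isolated_zero (\<lambda>z. v z - 1) a"
      using omits(3) lims
    proof eventually_elim
      case (elim a)
      then obtain m n where m: "(s \<longlongrightarrow> m) (at a)" "m \<noteq> 0" and n: "n \<noteq> 0" "n - 2 * m \<noteq> 0"
        "(\<kappa> \<longlongrightarrow> (n - 2 * m) / n) (at a)" "((\<lambda>z. t z + s z) \<longlongrightarrow> n) (at a)" by blast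
      have ne: "1 - 1 * ((n - 2 * m) / n) \<noteq> 0" using m n by (simp add: field_simps)
      show ?case
      proof
        assume v: "isolated_zero (\<lambda>z. v z - 1) a"
        then have "((\<lambda>z. (v z - 1) + 1) \<longlongrightarrow> 0 + 1) (at a)"
          by (intro tendsto_intros) (simp add: isolated_zero_def)
        then have v1: "(v \<longlongrightarrow> 1) (at a)" by simp
        have "isolated_zero (\<lambda>z. g z - t z) a"
          using v
        proof (rule isolated_zero_transfer)
          show "((\<lambda>z. \<kappa> z * (t z + s z) / (1 - v z * \<kappa> z)) \<longlongrightarrow>
              (n - 2 * m) / n * n / (1 - 1 * ((n - 2 * m) / n))) (at a)"
            by (intro tendsto_mult tendsto_divide tendsto_diff tendsto_const m n v1 ne)
          show "(n - 2 * m) / n * n / (1 - 1 * ((n - 2 * m) / n)) \<noteq> 0"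
            using m n ne by simp
          show "\<forall>\<^sub>F z in at a. g z - t z = (v z - 1) * (\<kappa> z * (t z + s z) / (1 - v z * \<kappa> z))"
            using nz_at by eventually_elim blast
        qed
        then show False using elim by blast
      qed
    qed
    show "\<forall>\<^sub>F a in at_infinity. \<not> is_pole v a"
      using omits(2) lims
    proof eventually_elim
      case (elim a)
      then obtain m n where m: "(s \<longlongrightarrow> m) (at a)" "m \<noteq> 0" and n: "n \<noteq> 0" "n - 2 * m \<noteq> 0"
        "(\<kappa> \<longlongrightarrow> (n - 2 * m) / n) (at a)" by blast
      show ?case
      proof
        assume "is_pole v a"
        \<comment> \<open>At a pole of \<open>v\<close> the formulas are rewritten in
          \<open>inverse (v z)\<close>, which tends to 0, so that all limits involved are
          finite.\<close>
        then have w: "isolated_zero (\<lambda>z. inverse (v z)) a" by (simp add: isolated_zero_inverse_iff)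
        then have w0: "((\<lambda>z. inverse (v z)) \<longlongrightarrow> 0) (at a)" by (simp add: isolated_zero_def)
        have "isolated_zero (\<lambda>z. g z + s z) a"
          using w
        proof (rule isolated_zero_transfer)
          show "((\<lambda>z. 2 * s z / (inverse (v z) - \<kappa> z)) \<longlongrightarrow>
              2 * m / (0 - (n - 2 * m) / n)) (at a)"
            by (intro tendsto_intros m n w0) (use n in simp)
          show "2 * m / (0 - (n - 2 * m) / n) \<noteq> 0"
            using m n by simp
          have "\<forall>\<^sub>F z in at a. inverse (v z) \<noteq> 0" using w by (simp add: isolated_zero_def)
          then show "\<forall>\<^sub>F z in at a. g z + s z = inverse (v z) * (2 * s z / (inverse (v z) - \<kappa> z))"
            using nz_at
          proof eventually_elim
            case (elim z)
            have "inverse (v z) - \<kappa> z = (1 - v z * \<kappa> z) * inverse (v z)"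
              using elim(1) by (simp add: algebra_simps)
            then show ?case using elim by simp
          qed
        qed
        then show False using elim by blast
      qed
    qed
  qed
  then have "rational_function (\<lambda>z. 2 * s z / (1 - v z * \<kappa> z) - s z)"
    by (intro rational_function_intros s rat_\<kappa>)
  moreover have "\<forall>\<^sub>\<approx>z. g z = 2 * s z / (1 - v z * \<kappa> z) - s z"
    using nz by eventually_elim (simp add: eq_diff_eq)
  ultimately show ?thesis by (rule rational_function_cong)
qed

subsection \<open>The Riccati equation\<close>

locale q_Riccati =
  fixes q :: complex and A f :: "complex \<Rightarrow> complex"
  assumes rat_A: "rational_function A" and nonconst_A: "nonconstant A"
    and q_nz: "q \<noteq> 0" and norm_q: "cmod q \<noteq> 1"
    and trans: "transcendental_meromorphic f"
    and sol: "q_Riccati_solution q A f"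
begin

text \<open>Both 1 and -1 lie on the unit circle. The factor \<open>1 + q\<close> enters when
  \<open>u (q * z)\<close> is expressed through \<open>u z\<close>.\<close>

lemma q_simps: "q - 1 \<noteq> 0" "1 + q \<noteq> 0"
proof -
  show "q - 1 \<noteq> 0" using norm_q by auto
  show "1 + q \<noteq> 0"
  proof
    assume "1 + q = 0"
    then have "q = - 1" by (simp add: eq_neg_iff_add_eq_0 add.commute)
    then show False using norm_q by simp
  qed
qed

lemma f_meromorphic: "f meromorphic_on UNIV" and f_not_rational: "\<not> rational_function f"
  using trans by (auto simp: transcendental_meromorphic_def)

definition u where "u z = 1 - (q - 1) * z * f z"

lemma Riccati_cosparse:
  "\<forall>\<^sub>\<approx>z. z \<noteq> 0 \<and> u z \<noteq> 0 \<and> f (q * z) * u z = A z + f z"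
proof -
  have "u meromorphic_on UNIV"
    unfolding u_def by (intro meromorphic_intros f_meromorphic)
  then have "\<forall>\<^sub>\<approx>z. u z \<noteq> 0"
    using meromorphic_imp_constant_or_avoid[of u UNIV 0] sol
    by (auto simp: q_Riccati_solution_def u_def)
  moreover have "\<forall>\<^sub>\<approx>z::complex. z \<noteq> 0"
    using eventually_cosparse_poly_nonzero[of "[:0, 1:]"] by simp
  moreover have "\<forall>\<^sub>\<approx>z. f (q * z) = (A z + f z) / u z"
    using sol by (simp add: q_Riccati_solution_def u_def)
  ultimately show ?thesis by eventually_elim simp
qed

lemma Riccati_at:
  "\<forall>\<^sub>F z in at a. z \<noteq> 0 \<and> u z \<noteq> 0 \<and> f (q * z) * u z = A z + f z"
  using Riccati_cosparse by (rule eventually_cosparse_imp_eventually_at) simp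

text \<open>Writing \<open>f\<close> as \<open>f * u / u\<close> and using the equation gives the
  formula behind both halves: poles are sought at zeros of \<open>u\<close> and poles of
  \<open>f\<close>, zeros at roots of the numerator.\<close>

lemma q_difference_at:
  "\<forall>\<^sub>F z in at a. q_difference q f z = (A z + (q - 1) * z * (f z)\<^sup>2) / ((q - 1) * z * u z)"
  using Riccati_at
proof eventually_elim
  case (elim z)
  then have "f (q * z) = (A z + f z) / u z" by (simp add: field_simps)
  then have "f (q * z) - f z = (A z + f z - f z * u z) / u z"
    using elim by (simp add: diff_divide_distrib)
  also have "A z + f z - f z * u z = A z + (q - 1) * z * (f z)\<^sup>2"
    by (simp add: u_def algebra_simps power2_eq_square)
  finally show ?case by (simp add: q_difference_def mult.commute)
qed

lemma not_rational_scaled: "\<not> rational_function (\<lambda>z. f (q * z))"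
proof
  assume "rational_function (\<lambda>z. f (q * z))"
  then have "rational_function (\<lambda>z. f (q * (inverse q * z)))"
    using q_nz by (intro rational_function_scale[where R = "\<lambda>z. f (q * z)"]) auto
  then show False using f_not_rational q_nz by (simp flip: mult.assoc)
qed

text \<open>The expression is the determinant of the Moebius map sending \<open>f z\<close> to
  \<open>f (q * z)\<close>. If it vanished identically, the map would be constant in
  \<open>f z\<close>, and \<open>f (q * z)\<close> would be rational.\<close>

lemma Riccati_nondegenerate: "\<not> (\<forall>\<^sub>\<approx>z. 1 + (q - 1) * z * A z = 0)"
proof
  assume "\<forall>\<^sub>\<approx>z. 1 + (q - 1) * z * A z = 0"
  with Riccati_cosparse have "\<forall>\<^sub>\<approx>z. f (q * z) = - (1 / ((q - 1) * z))"
  proof eventually_elim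
    case (elim z)
    have "((q - 1) * z * f (q * z) + 1) * u z = (q - 1) * z * (f (q * z) * u z) + u z"
      by (simp add: algebra_simps)
    also have "\<dots> = (q - 1) * z * (A z + f z) + u z" using elim by simp
    also have "\<dots> = 1 + (q - 1) * z * A z" by (simp add: u_def algebra_simps)
    finally have "((q - 1) * z * f (q * z) + 1) * u z = 0" using elim by simp
    then have "(q - 1) * z * f (q * z) = - 1"
      using elim by (simp add: eq_neg_iff_add_eq_0)
    then have "f (q * z) = - 1 / ((q - 1) * z)"
      using elim q_simps by (metis divide_eq_eq mult.commute mult_eq_0_iff nonzero_mult_div_cancel_left)
    then show ?case by simp
  qed
  then have "rational_function (\<lambda>z. f (q * z))"
    by (rule rational_function_cong[rotated]) (intro rational_function_intros)
  then show False using not_rational_scaled by simp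
qed

section \<open>Local behaviour of solutions at generic points\<close>

text \<open>The points excluded by these conditions form a bounded set. The limit \<open>l\<close>
  stands for the value of \<open>A\<close>; the last condition says that the determinant of the
  Riccati map does not vanish at \<open>a\<close>.\<close>

definition generic :: "complex \<Rightarrow> complex \<Rightarrow> bool" where
  "generic a l \<longleftrightarrow> (A \<longlongrightarrow> l) (at a) \<and> a \<noteq> 0 \<and> l \<noteq> 0 \<and> 1 + (q - 1) * a * l \<noteq> 0"

lemma eventually_generic: "\<forall>\<^sub>F a in at_infinity. \<exists>l. generic a l"
proof -
  have "\<not> (\<forall>\<^sub>\<approx>z. A z = 0)"
    using nonconst_A by (auto simp: nonconstant_def)
  from rational_function_tendsto_nonzero[OF rat_A this]
  have 1: "\<forall>\<^sub>F a in at_infinity. \<exists>l. (A \<longlongrightarrow> l) (at a) \<and> l \<noteq> 0" .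
  have "rational_function (\<lambda>z. 1 + (q - 1) * z * A z)"
    by (intro rational_function_intros rat_A)
  from rational_function_tendsto_nonzero[OF this Riccati_nondegenerate]
  have "\<forall>\<^sub>F a in at_infinity. \<exists>l. ((\<lambda>z. 1 + (q - 1) * z * A z) \<longlongrightarrow> l) (at a) \<and> l \<noteq> 0" .
  moreover have "\<forall>\<^sub>F a::complex in at_infinity. a \<noteq> 0"
    using eventually_at_infinity_poly_nonzero[of "[:0, 1:]"] by simp
  ultimately show ?thesis
    using 1
  proof eventually_elim
    case (elim a)
    then obtain l l' where l: "(A \<longlongrightarrow> l) (at a)" "l \<noteq> 0"
        "((\<lambda>z. 1 + (q - 1) * z * A z) \<longlongrightarrow> l') (at a)" "l' \<noteq> 0" by blast
    have "((\<lambda>z. 1 + (q - 1) * z * A z) \<longlongrightarrow> 1 + (q - 1) * a * l) (at a)"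
      by (intro tendsto_intros l)
    then have "l' = 1 + (q - 1) * a * l"
      using l(3) tendsto_unique[OF at_neq_bot] by blast
    then show ?case using l elim unfolding generic_def by blast
  qed
qed

lemma f_eq: "z \<noteq> 0 \<Longrightarrow> f z = (1 - u z) / ((q - 1) * z)"
  using q_simps by (simp add: u_def)

text \<open>Where \<open>u\<close> vanishes, \<open>f\<close> tends to
  \<open>c = 1 / ((q - 1) * a)\<close>, and the numerator of \<open>q_difference\<close> tends to
  the determinant times \<open>c\<close>, which is nonzero, so nothing cancels the zero of the
  denominator.\<close>

lemma pole_if_u_zero:
  assumes a: "generic a l" and u: "isolated_zero u a"
  shows "is_pole (q_difference q f) a" "is_pole (\<lambda>z. q_difference q f z / f z) a"
proof -
  have u0: "(u \<longlongrightarrow> 0) (at a)" using u by (simp add: isolated_zero_def)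
  have A: "(A \<longlongrightarrow> l) (at a)" and a0: "a \<noteq> 0" and nz: "1 + (q - 1) * a * l \<noteq> 0"
    using a by (auto simp: generic_def)
  define c where "c = 1 / ((q - 1) * a)"
  have "((\<lambda>z. (1 - u z) / ((q - 1) * z)) \<longlongrightarrow> (1 - 0) / ((q - 1) * a)) (at a)"
    using a0 q_simps by (intro tendsto_intros u0) auto
  moreover have "\<forall>\<^sub>F z in at a. f z = (1 - u z) / ((q - 1) * z)"
    using Riccati_at by eventually_elim (simp add: f_eq)
  ultimately have f: "(f \<longlongrightarrow> c) (at a)"
    unfolding c_def by (simp add: tendsto_cong)
  have c: "c \<noteq> 0" using a0 q_simps by (simp add: c_def)
  have "(q - 1) * a * c = 1" using a0 q_simps by (simp add: c_def)
  then have "l + (q - 1) * a * c\<^sup>2 = (1 + (q - 1) * a * l) * c" by algebra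
  then have num: "l + (q - 1) * a * c\<^sup>2 \<noteq> 0" using nz c by simp
  show "is_pole (q_difference q f) a"
    using u
  proof (rule is_pole_transfer)
    show "((\<lambda>z. (A z + (q - 1) * z * (f z)\<^sup>2) / ((q - 1) * z)) \<longlongrightarrow>
        (l + (q - 1) * a * c\<^sup>2) / ((q - 1) * a)) (at a)"
      using a0 q_simps by (intro tendsto_intros A f) auto
    show "(l + (q - 1) * a * c\<^sup>2) / ((q - 1) * a) \<noteq> 0"
      using num a0 q_simps by simp
    show "\<forall>\<^sub>F z in at a. u z \<noteq> 0 \<longrightarrow> q_difference q f z =
        (A z + (q - 1) * z * (f z)\<^sup>2) / ((q - 1) * z) / u z"
      using q_difference_at by eventually_elim simp
  qed
  show "is_pole (\<lambda>z. q_difference q f z / f z) a"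
    using u
  proof (rule is_pole_transfer)
    show "((\<lambda>z. (A z + (q - 1) * z * (f z)\<^sup>2) / ((q - 1) * z * f z)) \<longlongrightarrow>
        (l + (q - 1) * a * c\<^sup>2) / ((q - 1) * a * c)) (at a)"
      using a0 q_simps c by (intro tendsto_intros A f) auto
    show "(l + (q - 1) * a * c\<^sup>2) / ((q - 1) * a * c) \<noteq> 0"
      using num a0 q_simps c by simp
    show "\<forall>\<^sub>F z in at a. u z \<noteq> 0 \<longrightarrow> q_difference q f z / f z =
        (A z + (q - 1) * z * (f z)\<^sup>2) / ((q - 1) * z * f z) / u z"
      using q_difference_at by eventually_elim (simp add: mult_ac)
  qed
qed

text \<open>Near a pole of \<open>f\<close> the quadratic numerator dominates the linear
  denominator, and \<open>q_difference q f\<close> behaves like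
  \<open>- f z / ((q - 1) * z)\<close>. The limits are computed in \<open>v = 1 / f\<close>.\<close>

lemma q_difference_pole_if_pole:
  assumes a: "generic a l" and f: "is_pole f a"
  shows "is_pole (q_difference q f) a"
proof -
  define v where "v = (\<lambda>z. inverse (f z))"
  have A: "(A \<longlongrightarrow> l) (at a)" and a0: "a \<noteq> 0"
    using a by (auto simp: generic_def)
  have v: "isolated_zero v a"
    using f by (simp add: v_def isolated_zero_inverse_iff)
  then have v0: "(v \<longlongrightarrow> 0) (at a)" by (simp add: isolated_zero_def)
  show ?thesis
    using v
  proof (rule is_pole_transfer)
    show "((\<lambda>z. (A z * (v z)\<^sup>2 + (q - 1) * z) / ((q - 1) * z * (v z - (q - 1) * z))) \<longlongrightarrow>
        (l * 0\<^sup>2 + (q - 1) * a) / ((q - 1) * a * (0 - (q - 1) * a))) (at a)"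
      using a0 q_simps by (intro tendsto_intros A v0) auto
    show "(l * 0\<^sup>2 + (q - 1) * a) / ((q - 1) * a * (0 - (q - 1) * a)) \<noteq> 0"
      using a0 q_simps by simp
    show "\<forall>\<^sub>F z in at a. v z \<noteq> 0 \<longrightarrow> q_difference q f z =
        (A z * (v z)\<^sup>2 + (q - 1) * z) / ((q - 1) * z * (v z - (q - 1) * z)) / v z"
      using q_difference_at Riccati_at
    proof (eventually_elim, intro impI)
      fix z assume D: "q_difference q f z = (A z + (q - 1) * z * (f z)\<^sup>2) / ((q - 1) * z * u z)"
        and "z \<noteq> 0 \<and> u z \<noteq> 0 \<and> f (q * z) * u z = A z + f z" and "v z \<noteq> 0"
      then have z: "f z \<noteq> 0" "f z * v z = 1" by (auto simp: v_def)
      have "A z * (v z)\<^sup>2 + (q - 1) * z = (A z + (q - 1) * z * (f z)\<^sup>2) * (v z)\<^sup>2"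
        using z by (simp add: v_def field_simps)
      moreover have "v z - (q - 1) * z = u z * v z"
        using z(1) by (simp add: u_def v_def field_simps)
      ultimately show "q_difference q f z =
        (A z * (v z)\<^sup>2 + (q - 1) * z) / ((q - 1) * z * (v z - (q - 1) * z)) / v z"
        using D \<open>v z \<noteq> 0\<close> by (simp add: power2_eq_square)
    qed
  qed
qed

text \<open>As \<open>f\<close> tends to 0, \<open>q_difference q f\<close> tends to
  \<open>l / ((q - 1) * a)\<close>, which is nonzero; dividing by \<open>f\<close> produces the
  pole.\<close>

lemma log_q_difference_pole_if_zero:
  assumes a: "generic a l" and f: "isolated_zero f a"
  shows "is_pole (\<lambda>z. q_difference q f z / f z) a"
  using f
proof (rule is_pole_transfer)
  have A: "(A \<longlongrightarrow> l) (at a)" and a0: "a \<noteq> 0" and l: "l \<noteq> 0"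
    using a by (auto simp: generic_def)
  have f0: "(f \<longlongrightarrow> 0) (at a)" using f by (simp add: isolated_zero_def)
  show "((\<lambda>z. (A z + (q - 1) * z * (f z)\<^sup>2) / ((q - 1) * z * (1 - (q - 1) * z * f z))) \<longlongrightarrow>
      (l + (q - 1) * a * 0\<^sup>2) / ((q - 1) * a * (1 - (q - 1) * a * 0))) (at a)"
    using a0 q_simps by (intro tendsto_intros A f0) auto
  show "(l + (q - 1) * a * 0\<^sup>2) / ((q - 1) * a * (1 - (q - 1) * a * 0)) \<noteq> 0"
    using l a0 q_simps by simp
  show "\<forall>\<^sub>F z in at a. f z \<noteq> 0 \<longrightarrow> q_difference q f z / f z =
      (A z + (q - 1) * z * (f z)\<^sup>2) / ((q - 1) * z * (1 - (q - 1) * z * f z)) / f z"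
    using q_difference_at by eventually_elim (simp add: u_def)
qed

text \<open>With \<open>v = 1 / f (q * z)\<close>, solving the equation for \<open>u\<close> gives
  \<open>u z * (v z + (q - 1) * z) = v z * (1 + (q - 1) * z * A z)\<close>, and both cofactors have
  nonzero limits.\<close>

lemma u_zero_if_scaled_pole:
  assumes a: "generic a l" and f: "is_pole f (q * a)"
  shows "isolated_zero u a"
proof -
  define v where "v = (\<lambda>z. inverse (f (q * z)))"
  have A: "(A \<longlongrightarrow> l) (at a)" and a0: "a \<noteq> 0" and nz: "1 + (q - 1) * a * l \<noteq> 0"
    using a by (auto simp: generic_def)
  have v: "isolated_zero v a"
    using is_pole_scale[OF q_nz f] unfolding v_def by (simp add: isolated_zero_inverse_iff)
  then have v0: "(v \<longlongrightarrow> 0) (at a)" by (simp add: isolated_zero_def)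
  show ?thesis
    using v
  proof (rule isolated_zero_transfer)
    show lim: "((\<lambda>z. (1 + (q - 1) * z * A z) / (v z + (q - 1) * z)) \<longlongrightarrow>
        (1 + (q - 1) * a * l) / (0 + (q - 1) * a)) (at a)"
      using a0 q_simps by (intro tendsto_intros A v0) auto
    show "(1 + (q - 1) * a * l) / (0 + (q - 1) * a) \<noteq> 0"
      using nz a0 q_simps by simp
    have "((\<lambda>z. v z + (q - 1) * z) \<longlongrightarrow> 0 + (q - 1) * a) (at a)"
      by (intro tendsto_intros v0)
    then have "\<forall>\<^sub>F z in at a. v z + (q - 1) * z \<noteq> 0"
      by (rule tendsto_imp_eventually_ne) (use a0 q_simps in simp)
    moreover have "\<forall>\<^sub>F z in at a. v z \<noteq> 0"
      using v by (simp add: isolated_zero_def)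
    ultimately show "\<forall>\<^sub>F z in at a. u z = v z * ((1 + (q - 1) * z * A z) / (v z + (q - 1) * z))"
      using Riccati_at
    proof eventually_elim
      case (elim z)
      have "u z + (q - 1) * z * (f (q * z) * u z) = u z + (q - 1) * z * (A z + f z)"
        using elim by simp
      also have "\<dots> = 1 + (q - 1) * z * A z" by (simp add: u_def algebra_simps)
      finally have "v z * (1 + (q - 1) * z * A z) = v z * (u z + (q - 1) * z * (f (q * z) * u z))"
        by simp
      also have "\<dots> = u z * (v z + (q - 1) * z)"
        using elim(2) by (simp add: v_def field_simps)
      finally show ?case using elim(1) by (simp add: field_simps)
    qed
  qed
qed

text \<open>By the equation, \<open>u (q * z) = 0\<close> exactly when \<open>u z = k z\<close>, for generic \<open>z\<close>.\<close>

definition k where "k z = q * (1 + (q - 1) * z * A z) / (1 + q)"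

lemma k_tendsto:
  assumes "generic a l"
  shows "\<exists>c. (k \<longlongrightarrow> c) (at a) \<and> c \<noteq> 0"
proof (intro exI conjI)
  show "(k \<longlongrightarrow> q * (1 + (q - 1) * a * l) / (1 + q)) (at a)"
    unfolding k_def using assms q_simps by (intro tendsto_intros) (auto simp: generic_def)
  show "q * (1 + (q - 1) * a * l) / (1 + q) \<noteq> 0"
    using assms q_simps q_nz by (simp add: generic_def)
qed

text \<open>The identity behind this is \<open>u (q * z) * u z = (1 + q) * (u z - k z)\<close>. At a
  zero of \<open>u - k\<close> the function \<open>u\<close> shares the nonzero limit of
  \<open>k\<close>, so division by \<open>u z\<close> is harmless.\<close>

lemma u_zero_scaled_if_k:
  assumes a: "generic a l" and u: "isolated_zero (\<lambda>z. u z - k z) a"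
  shows "isolated_zero u (q * a)"
proof (rule isolated_zero_scale[OF q_nz])
  obtain c where c: "(k \<longlongrightarrow> c) (at a)" "c \<noteq> 0" using k_tendsto[OF a] by blast
  have "((\<lambda>z. (u z - k z) + k z) \<longlongrightarrow> 0 + c) (at a)"
    using u by (intro tendsto_intros c) (simp add: isolated_zero_def)
  then have u_lim: "(u \<longlongrightarrow> c) (at a)" by simp
  show "isolated_zero (\<lambda>z. u (q * z)) a"
    using u
  proof (rule isolated_zero_transfer)
    show "((\<lambda>z. (1 + q) / u z) \<longlongrightarrow> (1 + q) / c) (at a)"
      using c by (intro tendsto_intros u_lim)
    show "(1 + q) / c \<noteq> 0" using c q_simps by simp
    show "\<forall>\<^sub>F z in at a. u (q * z) = (u z - k z) * ((1 + q) / u z)"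
      using Riccati_at
    proof eventually_elim
      case (elim z)
      have "u (q * z) * u z = u z - (q - 1) * q * z * (f (q * z) * u z)"
        by (simp add: u_def algebra_simps)
      also have "\<dots> = u z - (q - 1) * q * z * (A z + f z)" using elim by simp
      also have "\<dots> = (1 + q) * u z - q * (1 + (q - 1) * z * A z)"
        by (simp add: u_def algebra_simps)
      also have "\<dots> = (1 + q) * (u z - k z)"
        using q_simps by (simp add: k_def right_diff_distrib)
      finally show ?case using elim by (simp add: field_simps)
    qed
  qed
qed

lemma k_rational: "rational_function k"
  unfolding k_def
  by (intro rational_function_intros rat_A)

lemma u_not_rational:
  "\<not> rational_function u"
proof
  assume "rational_function u"
  then have "rational_function (\<lambda>z. (1 - u z) / ((q - 1) * z))"
    by (intro rational_function_intros)
  moreover have "\<forall>\<^sub>\<approx>z. f z = (1 - u z) / ((q - 1) * z)"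
    using Riccati_cosparse by eventually_elim (simp add: f_eq)
  ultimately have "rational_function f" by (rule rational_function_cong)
  then show False using f_not_rational by blast
qed

lemma u_meromorphic: "u meromorphic_on UNIV"
  unfolding u_def by (intro meromorphic_intros f_meromorphic)

section \<open>Infinitely many poles\<close>

text \<open>Far out, \<open>u / k\<close> has no zeros because zeros of \<open>u\<close> are poles
  of \<open>q_difference q f\<close>, no poles because these would be poles of \<open>f\<close>, and
  no 1-points because a 1-point at \<open>a\<close> would be a zero of \<open>u\<close> at
  \<open>q * a\<close>.\<close>

lemma infinite_poles_q_difference: "infinite (poles (q_difference q f))"
proof
  assume "finite (poles (q_difference q f))"
  then have no_pole: "\<forall>\<^sub>F a in at_infinity. \<not> is_pole (q_difference q f) a"
    unfolding poles_def by (rule eventually_at_infinity_not_if_finite)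
  have no_zero: "\<forall>\<^sub>F a in at_infinity. \<not> isolated_zero u a"
    using no_pole eventually_generic by eventually_elim (use pole_if_u_zero in blast)
  define g where "g = (\<lambda>z. u z / k z)"
  have "rational_function g"
  proof (rule Picard_rational_function)
    show "g meromorphic_on UNIV"
      unfolding g_def by (intro meromorphic_intros u_meromorphic rational_function_meromorphic k_rational)
    show "\<forall>\<^sub>F a in at_infinity. \<not> is_pole g a"
      using no_pole eventually_generic
    proof eventually_elim
      case (elim a)
      then obtain l where l: "generic a l" by blast
      then obtain c where c: "(k \<longlongrightarrow> c) (at a)" "c \<noteq> 0" using k_tendsto by blast
      have a0: "a \<noteq> 0" using l by (simp add: generic_def)
      show ?case
      proof
        assume "is_pole g a"
        then have v: "isolated_zero (\<lambda>z. inverse (g z)) a" by (simp add: isolated_zero_inverse_iff)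
        then have v0: "((\<lambda>z. inverse (g z)) \<longlongrightarrow> 0) (at a)" by (simp add: isolated_zero_def)
        have "is_pole f a"
          using v
        proof (rule is_pole_transfer)
          \<comment> \<open>Since \<open>u = g * k\<close>, one has
            \<open>f z = (1 - g z * k z) / ((q - 1) * z)\<close>; here \<open>g z\<close> is
            factored out.\<close>
          show "((\<lambda>z. (inverse (g z) - k z) / ((q - 1) * z)) \<longlongrightarrow> (0 - c) / ((q - 1) * a)) (at a)"
            using a0 q_simps by (intro tendsto_intros c v0) auto
          show "(0 - c) / ((q - 1) * a) \<noteq> 0" using c a0 q_simps by simp
          have "\<forall>\<^sub>F z in at a. k z \<noteq> 0" using c by (rule tendsto_imp_eventually_ne)
          then show "\<forall>\<^sub>F z in at a. inverse (g z) \<noteq> 0 \<longrightarrow>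
              f z = (inverse (g z) - k z) / ((q - 1) * z) / inverse (g z)"
            using Riccati_at by eventually_elim (use q_simps in \<open>auto simp: f_eq g_def field_simps\<close>)
        qed
        then show False using elim l q_difference_pole_if_pole by blast
      qed
    qed
    show "\<forall>\<^sub>F a in at_infinity. \<not> isolated_zero g a"
      using no_zero eventually_generic
    proof eventually_elim
      case (elim a)
      then obtain l where l: "generic a l" by blast
      then obtain c where c: "(k \<longlongrightarrow> c) (at a)" "c \<noteq> 0" using k_tendsto by blast
      show ?case
      proof
        assume "isolated_zero g a"
        moreover have "\<forall>\<^sub>F z in at a. k z \<noteq> 0" using c by (rule tendsto_imp_eventually_ne)
        then have "\<forall>\<^sub>F z in at a. u z = g z * k z" by eventually_elim (simp add: g_def)
        ultimately show False using isolated_zero_transfer c elim by blast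
      qed
    qed
    show "\<forall>\<^sub>F a in at_infinity. \<not> isolated_zero (\<lambda>z. g z - 1) a"
      using eventually_at_infinity_scale[OF q_nz no_zero] eventually_generic
    proof eventually_elim
      case (elim a)
      then obtain l where l: "generic a l" by blast
      then obtain c where c: "(k \<longlongrightarrow> c) (at a)" "c \<noteq> 0" using k_tendsto by blast
      show ?case
      proof
        assume iz: "isolated_zero (\<lambda>z. g z - 1) a"
        have "\<forall>\<^sub>F z in at a. k z \<noteq> 0" using c by (rule tendsto_imp_eventually_ne)
        then have "\<forall>\<^sub>F z in at a. u z - k z = (g z - 1) * k z"
          by eventually_elim (simp add: g_def left_diff_distrib)
        with iz c have "isolated_zero (\<lambda>z. u z - k z) a"
          by (rule isolated_zero_transfer)
        then show False using u_zero_scaled_if_k l elim by blast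
      qed
    qed
  qed
  then have "rational_function (\<lambda>z. g z * k z)"
    using k_rational by (rule rational_function_mult)
  moreover have "\<forall>\<^sub>\<approx>z. k z \<noteq> 0"
    using meromorphic_imp_constant_or_avoid[OF rational_function_meromorphic[OF k_rational], of 0]
      Riccati_nondegenerate q_nz q_simps by (auto simp: k_def)
  then have "\<forall>\<^sub>\<approx>z. u z = g z * k z" by eventually_elim (simp add: g_def)
  ultimately have "rational_function u" by (rule rational_function_cong)
  then show False using u_not_rational by blast
qed

text \<open>A pole of \<open>f\<close> at \<open>a\<close> need not be a pole of the quotient, which
  has a finite limit there. It is excluded one step earlier on the orbit, since it forces a zero of
  \<open>u\<close> at \<open>a / q\<close>. Then \<open>u\<close> omits 0, 1 and infinity far out,
  its 1-points being zeros of \<open>f\<close>.\<close>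

lemma infinite_poles_log_q_difference: "infinite (poles (\<lambda>z. q_difference q f z / f z))"
proof
  assume "finite (poles (\<lambda>z. q_difference q f z / f z))"
  then have no_pole: "\<forall>\<^sub>F a in at_infinity. \<not> is_pole (\<lambda>z. q_difference q f z / f z) a"
    unfolding poles_def by (rule eventually_at_infinity_not_if_finite)
  have no_zero: "\<forall>\<^sub>F a in at_infinity. \<not> isolated_zero u a"
    using no_pole eventually_generic by eventually_elim (use pole_if_u_zero in blast)
  have "\<forall>\<^sub>F a in at_infinity. \<not> is_pole f (q * a)"
    using no_zero eventually_generic by eventually_elim (use u_zero_if_scaled_pole in blast)
  then have "\<forall>\<^sub>F a in at_infinity. \<not> is_pole f (q * (inverse q * a))"
    by (rule eventually_at_infinity_scale[rotated]) (use q_nz in simp)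
  then have no_pole_f: "\<forall>\<^sub>F a in at_infinity. \<not> is_pole f a"
    using q_nz by (simp flip: mult.assoc)
  have "rational_function u"
  proof (rule Picard_rational_function[OF u_meromorphic _ no_zero])
    show "\<forall>\<^sub>F a in at_infinity. \<not> is_pole u a"
      using no_pole_f eventually_generic
    proof eventually_elim
      case (elim a)
      then obtain l where a0: "a \<noteq> 0" by (auto simp: generic_def)
      show ?case
      proof
        assume "is_pole u a"
        then have v: "isolated_zero (\<lambda>z. inverse (u z)) a" by (simp add: isolated_zero_inverse_iff)
        then have v0: "((\<lambda>z. inverse (u z)) \<longlongrightarrow> 0) (at a)" by (simp add: isolated_zero_def)
        have "is_pole f a"
          using v
        proof (rule is_pole_transfer)
          show "((\<lambda>z. (inverse (u z) - 1) / ((q - 1) * z)) \<longlongrightarrow> (0 - 1) / ((q - 1) * a)) (at a)"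
            using a0 q_simps by (intro tendsto_intros v0) auto
          show "(0 - 1) / ((q - 1) * a) \<noteq> 0" using a0 q_simps by simp
          show "\<forall>\<^sub>F z in at a. inverse (u z) \<noteq> 0 \<longrightarrow>
              f z = (inverse (u z) - 1) / ((q - 1) * z) / inverse (u z)"
            using Riccati_at by eventually_elim (use q_simps in \<open>auto simp: f_eq field_simps\<close>)
        qed
        then show False using elim by blast
      qed
    qed
    show "\<forall>\<^sub>F a in at_infinity. \<not> isolated_zero (\<lambda>z. u z - 1) a"
      using no_pole eventually_generic
    proof eventually_elim
      case (elim a)
      then obtain l where l: "generic a l" by blast
      then have a0: "a \<noteq> 0" by (simp add: generic_def)
      show ?case
      proof
        assume "isolated_zero (\<lambda>z. u z - 1) a"
        then have "isolated_zero f a"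
        proof (rule isolated_zero_transfer)
          show "((\<lambda>z. - 1 / ((q - 1) * z)) \<longlongrightarrow> - 1 / ((q - 1) * a)) (at a)"
            using a0 q_simps by (intro tendsto_intros) auto
          show "- 1 / ((q - 1) * a) \<noteq> 0" using a0 q_simps by simp
          show "\<forall>\<^sub>F z in at a. f z = (u z - 1) * (- 1 / ((q - 1) * z))"
            using Riccati_at by eventually_elim (simp add: f_eq diff_divide_distrib)
        qed
        then show False using log_q_difference_pole_if_zero l elim by blast
      qed
    qed
  qed
  then show False using u_not_rational by blast
qed

section \<open>Infinitely many zeros\<close>

text \<open>\<open>\<sigma>\<close> stands for either square root, \<open>s\<close> or
  \<open>- s\<close>. The numerator factors, so \<open>q_difference q f\<close> equals
  \<open>(f - \<sigma>) * (f + \<sigma>) / u\<close>; at a zero of the first factor,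
  \<open>f + \<sigma>\<close>, \<open>u\<close> and \<open>f\<close> have nonzero limits.\<close>

lemma
  assumes \<sigma>: "(\<sigma> \<longlongrightarrow> m) (at a)" "m \<noteq> 0" "1 - (q - 1) * a * m \<noteq> 0" and a: "a \<noteq> 0"
    and A: "\<forall>\<^sub>F z in at a. A z = - (q - 1) * z * (\<sigma> z)\<^sup>2"
    and f: "isolated_zero (\<lambda>z. f z - \<sigma> z) a"
  shows q_difference_zero: "isolated_zero (q_difference q f) a"
    and log_q_difference_zero: "isolated_zero (\<lambda>z. q_difference q f z / f z) a"
proof -
  have "((\<lambda>z. (f z - \<sigma> z) + \<sigma> z) \<longlongrightarrow> 0 + m) (at a)"
    using f by (intro tendsto_intros \<sigma>) (simp add: isolated_zero_def)
  then have f_lim: "(f \<longlongrightarrow> m) (at a)" by simp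
  have u_lim: "(u \<longlongrightarrow> 1 - (q - 1) * a * m) (at a)"
    unfolding u_def by (intro tendsto_intros f_lim)
  have D: "\<forall>\<^sub>F z in at a. q_difference q f z = (f z - \<sigma> z) * ((f z + \<sigma> z) / u z)"
    using q_difference_at A Riccati_at
  proof eventually_elim
    case (elim z)
    have "A z + (q - 1) * z * (f z)\<^sup>2 = (q - 1) * z * ((f z - \<sigma> z) * (f z + \<sigma> z))"
      unfolding elim(2) by (simp add: algebra_simps power2_eq_square)
    then show ?case using elim q_simps by simp
  qed
  show "isolated_zero (q_difference q f) a"
    using f
  proof (rule isolated_zero_transfer[OF _ _ _ D])
    show "((\<lambda>z. (f z + \<sigma> z) / u z) \<longlongrightarrow> (m + m) / (1 - (q - 1) * a * m)) (at a)"
      by (intro tendsto_intros f_lim \<sigma> u_lim)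
    show "(m + m) / (1 - (q - 1) * a * m) \<noteq> 0"
      using \<sigma> by simp
  qed
  show "isolated_zero (\<lambda>z. q_difference q f z / f z) a"
    using f
  proof (rule isolated_zero_transfer)
    show "((\<lambda>z. (f z + \<sigma> z) / u z / f z) \<longlongrightarrow> (m + m) / (1 - (q - 1) * a * m) / m) (at a)"
      by (intro tendsto_intros f_lim \<sigma> u_lim)
    show "(m + m) / (1 - (q - 1) * a * m) / m \<noteq> 0"
      using \<sigma> by simp
    show "\<forall>\<^sub>F z in at a. q_difference q f z / f z = (f z - \<sigma> z) * ((f z + \<sigma> z) / u z / f z)"
      using D by eventually_elim simp
  qed
qed

text \<open>\<open>\<sigma> z\<close> is a fixed point of the Riccati map at \<open>z\<close>.
  Inverting that map expresses \<open>f z - \<sigma> z\<close> as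
  \<open>f (q * z) - \<sigma> z\<close> times a factor with nonzero limit.\<close>

lemma zero_if_scaled_zero:
  assumes \<sigma>: "(\<sigma> \<longlongrightarrow> m) (at a)"
    and m: "1 - (q - 1) * a * m \<noteq> 0" "1 + (q - 1) * a * m \<noteq> 0"
    and A: "\<forall>\<^sub>F z in at a. A z = - (q - 1) * z * (\<sigma> z)\<^sup>2"
    and f: "isolated_zero (\<lambda>z. f (q * z) - \<sigma> z) a"
  shows "isolated_zero (\<lambda>z. f z - \<sigma> z) a"
  using f
proof (rule isolated_zero_transfer)
  have "((\<lambda>z. (f (q * z) - \<sigma> z) + \<sigma> z) \<longlongrightarrow> 0 + m) (at a)"
    using f by (intro tendsto_intros \<sigma>) (simp add: isolated_zero_def)
  then have f_lim: "((\<lambda>z. f (q * z)) \<longlongrightarrow> m) (at a)" by simp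
  show "((\<lambda>z. (1 - (q - 1) * z * \<sigma> z) / (1 + (q - 1) * z * f (q * z))) \<longlongrightarrow>
      (1 - (q - 1) * a * m) / (1 + (q - 1) * a * m)) (at a)"
    by (intro tendsto_intros \<sigma> f_lim m)
  show "(1 - (q - 1) * a * m) / (1 + (q - 1) * a * m) \<noteq> 0" using m by simp
  have "((\<lambda>z. 1 + (q - 1) * z * f (q * z)) \<longlongrightarrow> 1 + (q - 1) * a * m) (at a)"
    by (intro tendsto_intros f_lim)
  then have "\<forall>\<^sub>F z in at a. 1 + (q - 1) * z * f (q * z) \<noteq> 0"
    using m(2) by (rule tendsto_imp_eventually_ne)
  then show "\<forall>\<^sub>F z in at a. f z - \<sigma> z =
      (f (q * z) - \<sigma> z) * ((1 - (q - 1) * z * \<sigma> z) / (1 + (q - 1) * z * f (q * z)))"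
    using Riccati_at A
  proof eventually_elim
    case (elim z)
    have "f (q * z) * u z = A z + f z" using elim by simp
    then have "f z * (1 + (q - 1) * z * f (q * z)) = f (q * z) - A z"
      unfolding u_def by (simp add: algebra_simps)
    then have "(f z - \<sigma> z) * (1 + (q - 1) * z * f (q * z)) =
        f (q * z) - A z - \<sigma> z * (1 + (q - 1) * z * f (q * z))"
      by (simp add: left_diff_distrib)
    also have "\<dots> = (f (q * z) - \<sigma> z) * (1 - (q - 1) * z * \<sigma> z)"
      unfolding elim(3) by (simp add: algebra_simps power2_eq_square)
    finally show ?case using elim(1) by (simp add: field_simps)
  qed
qed

text \<open>The first identity would make \<open>s\<close> invariant under \<open>q\<close>, the
  second, applied twice, under \<open>q * q\<close>. Neither multiplier has modulus 1, so
  \<open>s\<close> would be constant.\<close>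

lemma scale_not_plus_minus:
  assumes s: "rational_function s" "nonconstant s"
  shows "\<not> (\<forall>\<^sub>\<approx>z. s (q * z) - s z = 0)" "\<not> (\<forall>\<^sub>\<approx>z. s (q * z) + s z = 0)"
proof -
  show "\<not> (\<forall>\<^sub>\<approx>z. s (q * z) - s z = 0)"
    using rational_function_scale_invariant[OF s(1) q_nz norm_q] s(2)
    by (auto simp: nonconstant_def)
  show "\<not> (\<forall>\<^sub>\<approx>z. s (q * z) + s z = 0)"
  proof
    assume *: "\<forall>\<^sub>\<approx>z. s (q * z) + s z = 0"
    from eventually_cosparse_scale[OF q_nz *] *
    have "\<forall>\<^sub>\<approx>z. s (q * q * z) = s z"
    proof eventually_elim
      case (elim z)
      then have "s (q * (q * z)) = s z" by algebra
      then show ?case by (simp add: mult.assoc)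
    qed
    moreover have "cmod (q * q) \<noteq> 1"
      using norm_q norm_ge_zero[of q] square_eq_1_iff[of "cmod q"] unfolding norm_mult by linarith
    ultimately show False
      using rational_function_scale_invariant[OF s(1), of "q * q"] q_nz s(2)
      by (auto simp: nonconstant_def)
  qed
qed

text \<open>At a generic point \<open>l = - (q - 1) * a * m\<^sup>2\<close>, and the determinant
  factors as \<open>(1 - (q - 1) * a * m) * (1 + (q - 1) * a * m)\<close>; genericity therefore
  yields all the conditions on \<open>m\<close>.\<close>

lemma eventually_square_root_limit:
  assumes s: "rational_function s" and A: "\<forall>\<^sub>\<approx>z. A z = - (q - 1) * z * (s z)\<^sup>2"
  shows "\<forall>\<^sub>F a in at_infinity. \<exists>m. (s \<longlongrightarrow> m) (at a) \<and> m \<noteq> 0 \<and>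
    1 - (q - 1) * a * m \<noteq> 0 \<and> 1 + (q - 1) * a * m \<noteq> 0 \<and> a \<noteq> 0"
  using rational_function_tendsto[OF s] eventually_generic
proof eventually_elim
  case (elim a)
  then obtain m l where m: "(s \<longlongrightarrow> m) (at a)" and l: "generic a l" by blast
  have "\<forall>\<^sub>F z in at a. A z = - (q - 1) * z * (s z)\<^sup>2"
    using A by (rule eventually_cosparse_imp_eventually_at) simp
  moreover have "((\<lambda>z. - (q - 1) * z * (s z)\<^sup>2) \<longlongrightarrow> - (q - 1) * a * m\<^sup>2) (at a)"
    by (intro tendsto_intros m)
  ultimately have "(A \<longlongrightarrow> - (q - 1) * a * m\<^sup>2) (at a)"
    by (simp add: tendsto_cong)
  then have l_eq: "l = - (q - 1) * a * m\<^sup>2"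
    using l tendsto_unique[OF at_neq_bot] unfolding generic_def by blast
  have "1 + (q - 1) * a * l = (1 - (q - 1) * a * m) * (1 + (q - 1) * a * m)"
    unfolding l_eq by algebra
  then show ?case using l m l_eq unfolding generic_def by auto
qed

text \<open>The function \<open>f (q * z)\<close> omits \<open>s z\<close> and \<open>- s z\<close>
  by the fixed point property and \<open>s (q * z)\<close> by rescaling. These three rational
  functions are distinct, so \<open>f (q * z)\<close> would be rational.\<close>

lemma not_avoids_square_roots:
  assumes s: "rational_function s" "nonconstant s"
    and A: "\<forall>\<^sub>\<approx>z. A z = - (q - 1) * z * (s z)\<^sup>2"
    and pos: "\<forall>\<^sub>F a in at_infinity. \<not> isolated_zero (\<lambda>z. f z - s z) a"
    and neg: "\<forall>\<^sub>F a in at_infinity. \<not> isolated_zero (\<lambda>z. f z + s z) a"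
  shows False
proof -
  have A_at: "\<forall>\<^sub>F z in at a. A z = - (q - 1) * z * (s z)\<^sup>2" for a
    using A by (rule eventually_cosparse_imp_eventually_at) simp
  have "rational_function (\<lambda>z. f (q * z))"
  proof (rule rational_if_omits_three[where s = s and t = "\<lambda>z. s (q * z)"])
    show "(\<lambda>z. f (q * z)) meromorphic_on UNIV"
      by (rule meromorphic_on_compose[OF f_meromorphic]) (auto intro!: analytic_intros)
    show "rational_function (\<lambda>z. s (q * z))"
      using s(1) q_nz by (rule rational_function_scale)
    show "\<not> (\<forall>\<^sub>\<approx>z. s z = 0)" using s(2) by (auto simp: nonconstant_def)
    show "\<forall>\<^sub>F a in at_infinity. \<not> isolated_zero (\<lambda>z. f (q * z) - s z) a"
      using pos eventually_square_root_limit[OF s(1) A]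
      by eventually_elim (use zero_if_scaled_zero[OF _ _ _ A_at] in blast)
    \<comment> \<open>\<open>A\<close> depends only on the square of \<open>s\<close>, so the lemmas
      for \<open>s\<close> also apply to \<open>- s\<close>.\<close>
    have A_at': "\<forall>\<^sub>F z in at a. A z = - (q - 1) * z * (- s z)\<^sup>2" for a
      using A_at by simp
    show "\<forall>\<^sub>F a in at_infinity. \<not> isolated_zero (\<lambda>z. f (q * z) + s z) a"
      using neg eventually_square_root_limit[OF s(1) A]
    proof eventually_elim
      case (elim a)
      then obtain m where m: "(s \<longlongrightarrow> m) (at a)" "1 - (q - 1) * a * m \<noteq> 0" "1 + (q - 1) * a * m \<noteq> 0"
        by blast
      show ?case
        using zero_if_scaled_zero[OF tendsto_minus[OF m(1)] _ _ A_at'] m elim(1) by auto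
    qed
    show "\<forall>\<^sub>F a in at_infinity. \<not> isolated_zero (\<lambda>z. f (q * z) - s (q * z)) a"
      using eventually_at_infinity_scale[OF q_nz pos]
      by eventually_elim (use isolated_zero_scale[OF q_nz, of "\<lambda>z. f z - s z"] in blast)
  qed (use s(1) scale_not_plus_minus[OF s] in simp_all)
  then show False using not_rational_scaled by simp
qed

lemma
  assumes s: "rational_function s" "nonconstant s"
    and A: "\<forall>\<^sub>\<approx>z. A z = - (q - 1) * z * (s z)\<^sup>2"
  shows infinite_zeros_q_difference: "infinite (zeros (q_difference q f))"
    and infinite_zeros_log_q_difference: "infinite (zeros (\<lambda>z. q_difference q f z / f z))"
proof -
  have A_at: "\<forall>\<^sub>F z in at a. A z = - (q - 1) * z * (s z)\<^sup>2" for a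
    using A by (rule eventually_cosparse_imp_eventually_at) simp
  then have A_at': "\<forall>\<^sub>F z in at a. A z = - (q - 1) * z * (- s z)\<^sup>2" for a
    by simp
  \<comment> \<open>A far zero of \<open>f - s\<close> or \<open>f + s\<close> is a common zero of
    both functions in the claim. Absence of common far zeros is thus already contradictory, and it
    follows from finiteness of either zero set.\<close>
  have avoid: False
    if no_zero: "\<forall>\<^sub>F a in at_infinity. \<not> (isolated_zero (q_difference q f) a \<and>
      isolated_zero (\<lambda>z. q_difference q f z / f z) a)"
  proof (rule not_avoids_square_roots[OF s A])
    show "\<forall>\<^sub>F a in at_infinity. \<not> isolated_zero (\<lambda>z. f z - s z) a"
      using no_zero eventually_square_root_limit[OF s(1) A]
      by eventually_elim
        (use q_difference_zero[OF _ _ _ _ A_at] log_q_difference_zero[OF _ _ _ _ A_at] in blast)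
    show "\<forall>\<^sub>F a in at_infinity. \<not> isolated_zero (\<lambda>z. f z + s z) a"
      using no_zero eventually_square_root_limit[OF s(1) A]
    proof eventually_elim
      case (elim a)
      then obtain m where m: "(s \<longlongrightarrow> m) (at a)" "m \<noteq> 0" "1 + (q - 1) * a * m \<noteq> 0" "a \<noteq> 0"
        by blast
      show ?case
        using q_difference_zero[OF tendsto_minus[OF m(1)] _ _ m(4) A_at']
          log_q_difference_zero[OF tendsto_minus[OF m(1)] _ _ m(4) A_at'] m elim(1) by auto
    qed
  qed
  have "\<forall>\<^sub>F a in at_infinity. \<not> isolated_zero g a" if "finite (zeros g)" for g
    using that unfolding zeros_def by (rule eventually_at_infinity_not_if_finite)
  then show "infinite (zeros (q_difference q f))"
    "infinite (zeros (\<lambda>z. q_difference q f z / f z))"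
    using avoid by (blast intro: eventually_mono)+
qed

end

theorem theorem4p2:
  fixes q :: complex and A f :: "complex \<Rightarrow> complex"
  assumes "rational_function A" and "nonconstant A"
    and "q \<noteq> 0" and "cmod q \<noteq> 1"
    and "transcendental_meromorphic f"
    and "q_Riccati_solution q A f"
  shows
    "(\<not> (\<forall>\<^sub>\<approx>z. A z = - (1 / ((q - 1) * z))) \<longrightarrow>
        infinite (poles (q_difference q f)) \<and>
        infinite (poles (\<lambda>z. q_difference q f z / f z))) \<and>
     (\<forall>s. rational_function s \<and> nonconstant s \<and>
          (\<forall>\<^sub>\<approx>z. A z = - (q - 1) * z * (s z)\<^sup>2) \<longrightarrow>
        infinite (zeros (q_difference q f)) \<and>
        infinite (zeros (\<lambda>z. q_difference q f z / f z)))"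
proof -
  interpret q_Riccati q A f
    using assms by unfold_locales
  show ?thesis
    using infinite_poles_q_difference infinite_poles_log_q_difference
      infinite_zeros_q_difference infinite_zeros_log_q_difference by blast
qed

end
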